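(* Let $W_\Box$ be the axiom schema $\Box(((x\rightarrow y)\rightarrow y)\wedge(y\rightarrow x))\rightarrow((\Box x\rightarrow\Box y)\rightarrow\Box y)$. Then the logic $MG+W_\Box$ is complete with respect to the class $\mathsf{MG}^\omega$ of witnessed Gödel–Kripke models.
   Context: Standard Gödel algebra $[0,1]_G$: $a\wedge b=\min$, $a\vee b=\max$, $a\rightarrow b=1$ if $a\le b$, else $b$; $\neg a=a\rightarrow0$. Formulas are built from propositional variables and $\bot$ with $\wedge,\vee,\rightarrow,\Box,\Diamond$ ($\neg\varphi:=\varphi\rightarrow\bot$, $\top:=\neg\bot$). A Gödel–Kripke model is $\langle W,R,e\rangle$, $W\ne\emptyset$, $R\colon W\times W\to[0,1]$, $e$ assigning values in $[0,1]$ to variables at each world, extended world-wise as a homomorphism into $[0,1]_G$, with $e(v,\Box\varphi)=\bigwedge_w(R(v,w)\rightarrow e(w,\varphi))$, $e(v,\Diamond\varphi)=\bigvee_w(R(v,w)\wedge e(w,\varphi))$. It is witnessed if for each $v$ and each $\Box\varphi,\Diamond\varphi$ there are $v_1,v_2$ with $e(v,\Box\varphi)=R(v,v_1)\rightarrow e(v_1,\varphi)$ and $e(v,\Diamond\varphi)=R(v,v_2)\wedge e(v_2,\varphi)$. $MG$: Gödel–Dummett propositional axioms; $\Box(\varphi\rightarrow\psi)\rightarrow(\Box\varphi\rightarrow\Box\psi)$; $\neg\neg\Box\varphi\rightarrow\Box\neg\neg\varphi$; $\Diamond(\varphi\vee\psi)\rightarrow(\Diamond\varphi\vee\Diamond\psi)$;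 $\Diamond\neg\neg\varphi\rightarrow\neg\neg\Diamond\varphi$; $\neg\Diamond\bot$; $\Diamond(\varphi\rightarrow\psi)\rightarrow(\Box\varphi\rightarrow\Diamond\psi)$; $(\Diamond\varphi\rightarrow\Box\psi)\rightarrow\Box(\varphi\rightarrow\psi)$; modus ponens; from theorem $\varphi$ infer $\Box\varphi$; from theorem $\varphi\rightarrow\psi$ infer $\Diamond\varphi\rightarrow\Diamond\psi$. Adding a schema adds all its substitution instances as axioms. Consequence is local ($\Gamma\vdash_L\varphi$ iff derivable by modus ponens from $\Gamma$ and theorems of $L$). $L$ is complete w.r.t. a class $\mathcal C$ if for all sets of formulas $\Gamma\cup\{\varphi\}$, $\Gamma\vdash_L\varphi$ iff for all models in $\mathcal C$ and worlds $v$, $e(v,\gamma)=1$ for all $\gamma\in\Gamma$ implies $e(v,\varphi)=1$. *)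

theory Defs
  imports Complex_Main
begin

text \<open>The language has countably many propositional variables, indexed by natural numbers.\<close>

datatype fm =
    Var nat
  | Bot  (\<open>\<^bold>\<bottom>\<close>)
  | And fm fm  (infixr \<open>\<^bold>\<and>\<close> 75)
  | Or fm fm  (infixr \<open>\<^bold>\<or>\<close> 70)
  | Imp fm fm  (infixr \<open>\<^bold>\<rightarrow>\<close> 65)
  | Box fm  (\<open>\<^bold>\<box> _\<close> [80] 80)
  | Dia fm  (\<open>\<^bold>\<diamond> _\<close> [80] 80)

abbreviation Neg :: "fm \<Rightarrow> fm"  (\<open>\<^bold>\<not> _\<close> [80] 80)
  where "\<^bold>\<not> \<phi> \<equiv> \<phi> \<^bold>\<rightarrow> \<^bold>\<bottom>"


section \<open>Semantics\<close>

definition godel_imp :: "real \<Rightarrow> real \<Rightarrow> real"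
  where "godel_imp a b = (if a \<le> b then 1 else b)"

record 'w gk_structure =
  worlds :: "'w set"
  acc :: "'w \<Rightarrow> 'w \<Rightarrow> real"
  atom_val :: "'w \<Rightarrow> nat \<Rightarrow> real"

definition gk_model :: "'w gk_structure \<Rightarrow> bool"
  where "gk_model M \<longleftrightarrow>
    worlds M \<noteq> {} \<and>
    (\<forall>v\<in>worlds M. \<forall>w\<in>worlds M. acc M v w \<in> {0..1}) \<and>
    (\<forall>v\<in>worlds M. \<forall>p. atom_val M v p \<in> {0..1})"

primrec eval :: "'w gk_structure \<Rightarrow> 'w \<Rightarrow> fm \<Rightarrow> real"
  where
    "eval M v (Var p) = atom_val M v p"
  | "eval M v \<^bold>\<bottom> = 0"
  | "eval M v (\<phi> \<^bold>\<and> \<psi>) = min (eval M v \<phi>) (eval M v \<psi>)"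
  | "eval M v (\<phi> \<^bold>\<or> \<psi>) = max (eval M v \<phi>) (eval M v \<psi>)"
  | "eval M v (\<phi> \<^bold>\<rightarrow> \<psi>) = godel_imp (eval M v \<phi>) (eval M v \<psi>)"
  | "eval M v (\<^bold>\<box> \<phi>) = (INF w\<in>worlds M. godel_imp (acc M v w) (eval M w \<phi>))"
  | "eval M v (\<^bold>\<diamond> \<phi>) = (SUP w\<in>worlds M. min (acc M v w) (eval M w \<phi>))"

text \<open>In a model, the infima and suprema above are taken in the reals over nonempty subsets of
  the unit interval, so they agree with those of the complete lattice \<open>[0,1]\<close>.\<close>

lemma eval_unit_interval:
  assumes "gk_model M" "v \<in> worlds M"
  shows "eval M v \<phi> \<in> {0..1}"
  using assms(2)
proof (induction \<phi> arbitrary: v)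
  case (Box \<phi>)
  let ?f = "\<lambda>w. godel_imp (acc M v w) (eval M w \<phi>)"
  have f: "?f w \<in> {0..1}" if "w \<in> worlds M" for w
    using Box.IH[OF that] by (auto simp: godel_imp_def)
  have "bdd_below (?f ` worlds M)"
    using f by (intro bdd_belowI2[where m = 0]) auto
  then have "(INF w\<in>worlds M. ?f w) \<le> 1"
    using f Box.prems by (intro cINF_lower2[of _ _ v]) auto
  moreover have "0 \<le> (INF w\<in>worlds M. ?f w)"
    using f Box.prems by (intro cINF_greatest) auto
  ultimately show ?case by simp
next
  case (Dia \<phi>)
  let ?f = "\<lambda>w. min (acc M v w) (eval M w \<phi>)"
  have f: "?f w \<in> {0..1}" if "w \<in> worlds M" for w
    using Dia.IH[OF that] assms(1) that Dia.prems by (auto simp: gk_model_def min_def)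
  have "bdd_above (?f ` worlds M)"
    using f by (intro bdd_aboveI2[where M = 1]) auto
  then have "0 \<le> (SUP w\<in>worlds M. ?f w)"
    using f Dia.prems by (intro cSUP_upper2[of _ _ v]) auto
  moreover have "(SUP w\<in>worlds M. ?f w) \<le> 1"
    using f Dia.prems by (intro cSUP_least) auto
  ultimately show ?case by simp
qed (use assms(1) in \<open>auto simp: gk_model_def godel_imp_def min_def max_def\<close>)

definition witnessed :: "'w gk_structure \<Rightarrow> bool"
  where "witnessed M \<longleftrightarrow> (\<forall>v\<in>worlds M. \<forall>\<phi>.
    (\<exists>v\<^sub>1\<in>worlds M. eval M v (\<^bold>\<box> \<phi>) = godel_imp (acc M v v\<^sub>1) (eval M v\<^sub>1 \<phi>)) \<and>
    (\<exists>v\<^sub>2\<in>worlds M. eval M v (\<^bold>\<diamond> \<phi>) = min (acc M v v\<^sub>2) (eval M v\<^sub>2 \<phi>)))"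

definition witnessed_gk_models :: "'w gk_structure set"
  where "witnessed_gk_models = {M. gk_model M \<and> witnessed M}"

definition local_consequence :: "'w gk_structure set \<Rightarrow> fm set \<Rightarrow> fm \<Rightarrow> bool"
  where "local_consequence \<C> \<Gamma> \<phi> \<longleftrightarrow>
    (\<forall>M\<in>\<C>. \<forall>v\<in>worlds M. (\<forall>\<gamma>\<in>\<Gamma>. eval M v \<gamma> = 1) \<longrightarrow> eval M v \<phi> = 1)"


section \<open>Proof systems\<close>

text \<open>Goedel--Dummett propositional logic: Hilbert axioms of intuitionistic logic
  plus prelinearity.\<close>

inductive godel_dummett_axiom :: "fm \<Rightarrow> bool"
  where
    K: "godel_dummett_axiom (\<phi> \<^bold>\<rightarrow> \<psi> \<^bold>\<rightarrow> \<phi>)"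
  | S: "godel_dummett_axiom ((\<phi> \<^bold>\<rightarrow> \<psi> \<^bold>\<rightarrow> \<chi>) \<^bold>\<rightarrow> (\<phi> \<^bold>\<rightarrow> \<psi>) \<^bold>\<rightarrow> \<phi> \<^bold>\<rightarrow> \<chi>)"
  | And_E1: "godel_dummett_axiom (\<phi> \<^bold>\<and> \<psi> \<^bold>\<rightarrow> \<phi>)"
  | And_E2: "godel_dummett_axiom (\<phi> \<^bold>\<and> \<psi> \<^bold>\<rightarrow> \<psi>)"
  | And_I: "godel_dummett_axiom (\<phi> \<^bold>\<rightarrow> \<psi> \<^bold>\<rightarrow> \<phi> \<^bold>\<and> \<psi>)"
  | Or_I1: "godel_dummett_axiom (\<phi> \<^bold>\<rightarrow> \<phi> \<^bold>\<or> \<psi>)"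
  | Or_I2: "godel_dummett_axiom (\<psi> \<^bold>\<rightarrow> \<phi> \<^bold>\<or> \<psi>)"
  | Or_E: "godel_dummett_axiom ((\<phi> \<^bold>\<rightarrow> \<chi>) \<^bold>\<rightarrow> (\<psi> \<^bold>\<rightarrow> \<chi>) \<^bold>\<rightarrow> \<phi> \<^bold>\<or> \<psi> \<^bold>\<rightarrow> \<chi>)"
  | Bot_E: "godel_dummett_axiom (\<^bold>\<bottom> \<^bold>\<rightarrow> \<phi>)"
  | Prelinearity: "godel_dummett_axiom ((\<phi> \<^bold>\<rightarrow> \<psi>) \<^bold>\<or> (\<psi> \<^bold>\<rightarrow> \<phi>))"

inductive modal_axiom :: "fm \<Rightarrow> bool"
  where
    K_Box: "modal_axiom (\<^bold>\<box> (\<phi> \<^bold>\<rightarrow> \<psi>) \<^bold>\<rightarrow> (\<^bold>\<box> \<phi> \<^bold>\<rightarrow> \<^bold>\<box> \<psi>))"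
  | Z_Box: "modal_axiom (\<^bold>\<not> (\<^bold>\<not> (\<^bold>\<box> \<phi>)) \<^bold>\<rightarrow> \<^bold>\<box> (\<^bold>\<not> (\<^bold>\<not> \<phi>)))"
  | D_Dia: "modal_axiom (\<^bold>\<diamond> (\<phi> \<^bold>\<or> \<psi>) \<^bold>\<rightarrow> (\<^bold>\<diamond> \<phi> \<^bold>\<or> \<^bold>\<diamond> \<psi>))"
  | Z_Dia: "modal_axiom (\<^bold>\<diamond> (\<^bold>\<not> (\<^bold>\<not> \<phi>)) \<^bold>\<rightarrow> \<^bold>\<not> (\<^bold>\<not> (\<^bold>\<diamond> \<phi>)))"
  | F_Dia: "modal_axiom (\<^bold>\<not> (\<^bold>\<diamond> \<^bold>\<bottom>))"
  | FS1: "modal_axiom (\<^bold>\<diamond> (\<phi> \<^bold>\<rightarrow> \<psi>) \<^bold>\<rightarrow> (\<^bold>\<box> \<phi> \<^bold>\<rightarrow> \<^bold>\<diamond> \<psi>))"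
  | FS2: "modal_axiom ((\<^bold>\<diamond> \<phi> \<^bold>\<rightarrow> \<^bold>\<box> \<psi>) \<^bold>\<rightarrow> \<^bold>\<box> (\<phi> \<^bold>\<rightarrow> \<psi>))"

text \<open>Theorems of \<open>MG\<close> extended by a set \<open>A\<close> of additional axioms. An extension by a schema is
  obtained by taking for \<open>A\<close> the set of all its instances.\<close>

inductive MG_theorem :: "fm set \<Rightarrow> fm \<Rightarrow> bool" for A :: "fm set"
  where
    Prop_Axiom: "godel_dummett_axiom \<phi> \<Longrightarrow> MG_theorem A \<phi>"
  | Modal_Axiom: "modal_axiom \<phi> \<Longrightarrow> MG_theorem A \<phi>"
  | Extra_Axiom: "\<phi> \<in> A \<Longrightarrow> MG_theorem A \<phi>"
  | MP: "MG_theorem A (\<phi> \<^bold>\<rightarrow> \<psi>) \<Longrightarrow> MG_theorem A \<phi> \<Longrightarrow> MG_theorem A \<psi>"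
  | Nec_Box: "MG_theorem A \<phi> \<Longrightarrow> MG_theorem A (\<^bold>\<box> \<phi>)"
  | Mon_Dia: "MG_theorem A (\<phi> \<^bold>\<rightarrow> \<psi>) \<Longrightarrow> MG_theorem A (\<^bold>\<diamond> \<phi> \<^bold>\<rightarrow> \<^bold>\<diamond> \<psi>)"

inductive MG_derives :: "fm set \<Rightarrow> fm set \<Rightarrow> fm \<Rightarrow> bool" for A \<Gamma> :: "fm set"
  where
    Premise: "\<phi> \<in> \<Gamma> \<Longrightarrow> MG_derives A \<Gamma> \<phi>"
  | Theorem: "MG_theorem A \<phi> \<Longrightarrow> MG_derives A \<Gamma> \<phi>"
  | MP: "MG_derives A \<Gamma> (\<phi> \<^bold>\<rightarrow> \<psi>) \<Longrightarrow> MG_derives A \<Gamma> \<phi> \<Longrightarrow> MG_derives A \<Gamma> \<psi>"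

definition W_Box :: "fm set"
  where "W_Box = {\<^bold>\<box> (((x \<^bold>\<rightarrow> y) \<^bold>\<rightarrow> y) \<^bold>\<and> (y \<^bold>\<rightarrow> x)) \<^bold>\<rightarrow> ((\<^bold>\<box> x \<^bold>\<rightarrow> \<^bold>\<box> y) \<^bold>\<rightarrow> \<^bold>\<box> y) | x y. True}"

text \<open>The set of worlds of a model is an arbitrary nonempty subset of the type \<open>'w\<close>. For infinite
  \<open>'w\<close> no generality is lost on either side: models with a finite set of worlds are included, and
  closing a world of a witnessed model under witnesses for all (countably many) formulas gives a
  countable witnessed submodel with the same values.\<close>

definition complete_wrt :: "(fm set \<Rightarrow> fm \<Rightarrow> bool) \<Rightarrow> 'w gk_structure set \<Rightarrow> bool"
  where "complete_wrt L \<C> \<longleftrightarrow> (\<forall>\<Gamma> \<phi>. L \<Gamma> \<phi> \<longleftrightarrow> local_consequence \<C> \<Gamma> \<phi>)"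

end

theory Submission
  imports Defs "HOL-Library.Countable" "HOL-Library.Infinite_Set" "HOL-Library.Diagonal_Subsequence"
begin

text \<open>
  Completeness. Let \<open>v\<close> be a \<open>[0,1]\<close>-valuation of all formulas (modal ones treated as atoms) in
  which every theorem is true, and let \<open>a = v (\<box>\<phi>) < 1\<close>. The formulas \<open>\<psi>\<close> with \<open>v (\<box>\<psi>) > a\<close>
  together with all \<open>\<phi> \<rightarrow> \<psi>\<close> such that \<open>v (\<box>\<psi>) = a\<close> do not derive \<open>\<phi>\<close>: this is exactly what
  \<open>W\<^sub>\<box>\<close> expresses. A linear theory extending them and omitting \<open>\<phi>\<close> is a countable chain with
  \<open>\<phi>\<close> below the top; embedding it suitably into \<open>[0,1]\<close> gives a successor in which \<open>\<phi>\<close> has value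
  exactly \<open>a\<close> and which is accessible to a degree above \<open>a\<close>. Successors witnessing \<open>\<diamond>\<phi>\<close> need
  no extra axiom.

  A single embedding cannot in general respect the constraints \<open>v (\<box>\<psi>) \<le> w \<psi> \<le> v (\<diamond>\<psi>)\<close> for infinitely many
  \<open>\<psi>\<close> at once, because suprema and infima of the bounds may collide. So the tree of witnesses is
  built for finite sets of constraints only. A diagonal subsequence of these trees decides every
  comparison between two values, and the resulting countable total preorder embeds into \<open>[0,1]\<close>.
  As all infima and suprema are attained, the semantics depends only on this order, so the limit
  tree is a witnessed model.
\<close>

section \<open>Soundness\<close>

lemma eval_box_le:
  assumes "gk_model M" "w \<in> worlds M"
  shows "eval M v (\<^bold>\<box> \<phi>) \<le> godel_imp (acc M v w) (eval M w \<phi>)"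
proof -
  have "bdd_below ((\<lambda>w. godel_imp (acc M v w) (eval M w \<phi>)) ` worlds M)"
    using eval_unit_interval[OF assms(1)]
    by (intro bdd_belowI2[where m = 0]) (auto simp: godel_imp_def)
  then show ?thesis
    using assms(2) by (auto intro: cINF_lower)
qed

lemma eval_dia_ge:
  assumes "gk_model M" "w \<in> worlds M"
  shows "min (acc M v w) (eval M w \<phi>) \<le> eval M v (\<^bold>\<diamond> \<phi>)"
proof -
  have "bdd_above ((\<lambda>w. min (acc M v w) (eval M w \<phi>)) ` worlds M)"
    using eval_unit_interval[OF assms(1)]
    by (intro bdd_aboveI2[where M = 1]) (auto simp: min_le_iff_disj)
  then show ?thesis
    using assms(2) by (auto intro: cSUP_upper)
qed

lemma godel_dummett_axiom_sound:
  assumes "godel_dummett_axiom \<phi>" "gk_model M" "v \<in> worlds M"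
  shows "eval M v \<phi> = 1"
  using assms(1)
proof cases
  case (Or_E \<phi> \<chi> \<psi>)
  then show ?thesis
    using eval_unit_interval[OF assms(2,3), of \<chi>] by (auto simp: godel_imp_def)
next
  case (S \<phi> \<psi> \<chi>)
  then show ?thesis
    using eval_unit_interval[OF assms(2,3), of \<chi>] eval_unit_interval[OF assms(2,3), of \<psi>]
    by (auto simp: godel_imp_def)
next
  case (Prelinearity \<phi> \<psi>)
  then show ?thesis
    using eval_unit_interval[OF assms(2,3), of \<phi>] eval_unit_interval[OF assms(2,3), of \<psi>]
    by (auto simp: godel_imp_def)
next
  case (K \<phi> \<psi>)
  then show ?thesis
    using eval_unit_interval[OF assms(2,3), of \<phi>] by (auto simp: godel_imp_def)
next
  case (And_I \<phi> \<psi>)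
  then show ?thesis
    using eval_unit_interval[OF assms(2,3), of \<phi>] eval_unit_interval[OF assms(2,3), of \<psi>]
    by (auto simp: godel_imp_def min_def)
next
  case (Bot_E \<phi>)
  then show ?thesis
    using eval_unit_interval[OF assms(2,3), of \<phi>] by (auto simp: godel_imp_def)
qed (auto simp: godel_imp_def)

context
  fixes M :: "'w gk_structure" and v :: 'w
  assumes M: "gk_model M" "witnessed M" and v: "v \<in> worlds M"
begin

lemma box_witness:
  obtains w where "w \<in> worlds M" "eval M v (\<^bold>\<box> \<phi>) = godel_imp (acc M v w) (eval M w \<phi>)"
  using M(2) v unfolding witnessed_def by blast

lemma dia_witness:
  obtains w where "w \<in> worlds M" "eval M v (\<^bold>\<diamond> \<phi>) = min (acc M v w) (eval M w \<phi>)"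
  using M(2) v unfolding witnessed_def by blast

lemma acc_unit_interval: "w \<in> worlds M \<Longrightarrow> 0 \<le> acc M v w \<and> acc M v w \<le> 1"
  using M(1) v unfolding gk_model_def by auto

lemma eval_nonneg_le_one: "w \<in> worlds M \<Longrightarrow> 0 \<le> eval M w \<phi> \<and> eval M w \<phi> \<le> 1"
  using eval_unit_interval[OF M(1)] by auto

text \<open>For each axiom, the world to look at is the witness of the box on the right or of the
  diamond on the left. There the other modal values are bounded by \<open>eval_box_le\<close> and
  \<open>eval_dia_ge\<close>, and what remains is a statement about finitely many reals. Only the
  propositional clauses of \<open>eval\<close> are unfolded, so that infima and suprema stay
  opaque.\<close>

lemma modal_axiom_sound:
  assumes "modal_axiom \<phi>"
  shows "eval M v \<phi> = 1"
  using assms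
proof cases
  case (K_Box \<phi> \<psi>)
  obtain w where w: "w \<in> worlds M" "eval M v (\<^bold>\<box> \<psi>) = godel_imp (acc M v w) (eval M w \<psi>)"
    by (rule box_witness)
  show ?thesis
    using w eval_box_le[OF M(1) w(1), of v "\<phi> \<^bold>\<rightarrow> \<psi>"] eval_box_le[OF M(1) w(1), of v \<phi>]
      eval_nonneg_le_one[OF v, of "\<^bold>\<box> \<phi>"] eval_nonneg_le_one[OF v, of "\<^bold>\<box> \<psi>"]
      eval_nonneg_le_one[OF v, of "\<^bold>\<box> (\<phi> \<^bold>\<rightarrow> \<psi>)"]
      eval_nonneg_le_one[OF w(1), of \<phi>] eval_nonneg_le_one[OF w(1), of \<psi>]
    unfolding K_Box godel_imp_def min_def max_def eval.simps(2-5) by (smt (verit))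
next
  case (Z_Box \<phi>)
  obtain w where w: "w \<in> worlds M"
    "eval M v (\<^bold>\<box> (\<^bold>\<not> (\<^bold>\<not> \<phi>))) = godel_imp (acc M v w) (eval M w (\<^bold>\<not> (\<^bold>\<not> \<phi>)))"
    by (rule box_witness)
  show ?thesis
    using w eval_box_le[OF M(1) w(1), of v \<phi>] acc_unit_interval[OF w(1)]
      eval_nonneg_le_one[OF v, of "\<^bold>\<box> \<phi>"] eval_nonneg_le_one[OF w(1), of \<phi>]
    unfolding Z_Box godel_imp_def min_def max_def eval.simps(2-5) by (smt (verit))
next
  case (D_Dia \<phi> \<psi>)
  obtain w where w: "w \<in> worlds M"
    "eval M v (\<^bold>\<diamond> (\<phi> \<^bold>\<or> \<psi>)) = min (acc M v w) (eval M w (\<phi> \<^bold>\<or> \<psi>))"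
    by (rule dia_witness)
  show ?thesis
    using w eval_dia_ge[OF M(1) w(1), of v \<phi>] eval_dia_ge[OF M(1) w(1), of v \<psi>]
    unfolding D_Dia godel_imp_def min_def max_def eval.simps(2-5) by (smt (verit))
next
  case (Z_Dia \<phi>)
  obtain w where w: "w \<in> worlds M"
    "eval M v (\<^bold>\<diamond> (\<^bold>\<not> (\<^bold>\<not> \<phi>))) = min (acc M v w) (eval M w (\<^bold>\<not> (\<^bold>\<not> \<phi>)))"
    by (rule dia_witness)
  show ?thesis
    using w eval_dia_ge[OF M(1) w(1), of v \<phi>] acc_unit_interval[OF w(1)]
      eval_nonneg_le_one[OF v, of "\<^bold>\<diamond> \<phi>"] eval_nonneg_le_one[OF w(1), of \<phi>]
    unfolding Z_Dia godel_imp_def min_def max_def eval.simps(2-5) by (smt (verit))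
next
  case F_Dia
  obtain w where w: "w \<in> worlds M" "eval M v (\<^bold>\<diamond> \<^bold>\<bottom>) = min (acc M v w) (eval M w \<^bold>\<bottom>)"
    by (rule dia_witness)
  show ?thesis
    using F_Dia w by (auto simp: godel_imp_def simp del: eval.simps(6,7))
next
  case (FS1 \<phi> \<psi>)
  obtain w where w: "w \<in> worlds M"
    "eval M v (\<^bold>\<diamond> (\<phi> \<^bold>\<rightarrow> \<psi>)) = min (acc M v w) (eval M w (\<phi> \<^bold>\<rightarrow> \<psi>))"
    by (rule dia_witness)
  show ?thesis
    using w eval_dia_ge[OF M(1) w(1), of v \<psi>] eval_box_le[OF M(1) w(1), of v \<phi>]
      eval_nonneg_le_one[OF v, of "\<^bold>\<box> \<phi>"] eval_nonneg_le_one[OF v, of "\<^bold>\<diamond> \<psi>"]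
      eval_nonneg_le_one[OF w(1), of \<phi>] eval_nonneg_le_one[OF w(1), of \<psi>]
      acc_unit_interval[OF w(1)]
    unfolding FS1 godel_imp_def min_def max_def eval.simps(2-5) by (smt (verit))
next
  case (FS2 \<phi> \<psi>)
  obtain w where w: "w \<in> worlds M"
    "eval M v (\<^bold>\<box> (\<phi> \<^bold>\<rightarrow> \<psi>)) = godel_imp (acc M v w) (eval M w (\<phi> \<^bold>\<rightarrow> \<psi>))"
    by (rule box_witness)
  show ?thesis
    using w eval_dia_ge[OF M(1) w(1), of v \<phi>] eval_box_le[OF M(1) w(1), of v \<psi>]
      eval_nonneg_le_one[OF v, of "\<^bold>\<box> \<psi>"] eval_nonneg_le_one[OF v, of "\<^bold>\<diamond> \<phi>"]
      eval_nonneg_le_one[OF w(1), of \<phi>] eval_nonneg_le_one[OF w(1), of \<psi>]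
      acc_unit_interval[OF w(1)]
    unfolding FS2 godel_imp_def min_def max_def eval.simps(2-5) by (smt (verit))
qed

text \<open>The interesting case is \<open>Box x\<close> \<le> \<open>Box y\<close> < 1. At a
  witness \<open>w\<close> of \<open>Box x\<close>, the value of \<open>x\<close> is then strictly
  below the degree and equals \<open>Box x\<close>, which forces \<open>x\<close> \<le>
  \<open>y\<close> at \<open>w\<close>. So the argument of the first box takes the value of
  \<open>x\<close> at \<open>w\<close>, and its box is at most \<open>Box x\<close> \<le>
  \<open>Box y\<close>.\<close>

lemma W_Box_sound:
  assumes "\<phi> \<in> W_Box"
  shows "eval M v \<phi> = 1"
proof -
  obtain x y where
    \<phi>: "\<phi> = \<^bold>\<box> (((x \<^bold>\<rightarrow> y) \<^bold>\<rightarrow> y) \<^bold>\<and> (y \<^bold>\<rightarrow> x)) \<^bold>\<rightarrow> ((\<^bold>\<box> x \<^bold>\<rightarrow> \<^bold>\<box> y) \<^bold>\<rightarrow> \<^bold>\<box> y)"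
    using assms unfolding W_Box_def by blast
  obtain w where w: "w \<in> worlds M" "eval M v (\<^bold>\<box> x) = godel_imp (acc M v w) (eval M w x)"
    by (rule box_witness)
  show ?thesis
    using w eval_box_le[OF M(1) w(1), of v y]
      eval_box_le[OF M(1) w(1), of v "((x \<^bold>\<rightarrow> y) \<^bold>\<rightarrow> y) \<^bold>\<and> (y \<^bold>\<rightarrow> x)"]
      eval_nonneg_le_one[OF v, of "\<^bold>\<box> x"] eval_nonneg_le_one[OF v, of "\<^bold>\<box> y"]
      eval_nonneg_le_one[OF v, of "\<^bold>\<box> (((x \<^bold>\<rightarrow> y) \<^bold>\<rightarrow> y) \<^bold>\<and> (y \<^bold>\<rightarrow> x))"]
      eval_nonneg_le_one[OF w(1), of x] eval_nonneg_le_one[OF w(1), of y]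
      acc_unit_interval[OF w(1)]
    unfolding \<phi> godel_imp_def min_def max_def eval.simps(2-5) by (smt (verit))
qed

end

lemma MG_theorem_sound:
  assumes "MG_theorem W_Box \<phi>" "gk_model M" "witnessed M" "v \<in> worlds M"
  shows "eval M v \<phi> = 1"
  using assms(1,4)
proof (induction arbitrary: v)
  case (MP \<phi> \<psi>)
  show ?case
    using MP.IH[OF MP.prems] eval_unit_interval[OF assms(2) MP.prems, of \<psi>]
    by (auto simp: godel_imp_def split: if_splits)
next
  case (Nec_Box \<phi>)
  obtain w where "w \<in> worlds M" "eval M v (\<^bold>\<box> \<phi>) = godel_imp (acc M v w) (eval M w \<phi>)"
    using box_witness[OF assms(2,3) Nec_Box.prems] .
  then show ?case
    using Nec_Box.IH acc_unit_interval[OF assms(2,3) Nec_Box.prems]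
    by (auto simp: godel_imp_def simp del: eval.simps(6,7))
next
  case (Mon_Dia \<phi> \<psi>)
  obtain w where w: "w \<in> worlds M" "eval M v (\<^bold>\<diamond> \<phi>) = min (acc M v w) (eval M w \<phi>)"
    using dia_witness[OF assms(2,3) Mon_Dia.prems] .
  then show ?case
    using Mon_Dia.IH[OF w(1)] eval_dia_ge[OF assms(2) w(1), of v \<psi>]
      eval_unit_interval[OF assms(2) w(1), of \<phi>]
    by (auto simp: godel_imp_def simp del: eval.simps(6,7) split: if_splits)
qed (simp_all only: godel_dummett_axiom_sound modal_axiom_sound W_Box_sound assms(2,3))

lemma MG_derives_sound:
  assumes "MG_derives W_Box \<Gamma> \<phi>"
  shows "local_consequence witnessed_gk_models \<Gamma> \<phi>"
  unfolding local_consequence_def witnessed_gk_models_def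
proof (intro ballI impI)
  fix M :: "'w gk_structure" and v
  assume M: "M \<in> {M. gk_model M \<and> witnessed M}" and v: "v \<in> worlds M"
    and \<Gamma>: "\<forall>\<gamma>\<in>\<Gamma>. eval M v \<gamma> = 1"
  from assms show "eval M v \<phi> = 1"
  proof induction
    case (MP \<phi> \<psi>)
    then show ?case
      using M eval_unit_interval[of M v \<psi>] v by (auto simp: godel_imp_def split: if_splits)
  qed (use M v \<Gamma> MG_theorem_sound[of _ M v] in auto)
qed


section \<open>Deductively closed linear theories\<close>

lemma MG_derives_mono:
  "MG_derives A \<Gamma> \<phi> \<Longrightarrow> \<Gamma> \<subseteq> \<Delta> \<Longrightarrow> MG_derives A \<Delta> \<phi>"
  by (induction rule: MG_derives.induct) (auto intro: MG_derives.intros)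

lemma MG_derives_empty_iff: "MG_derives A {} \<phi> \<longleftrightarrow> MG_theorem A \<phi>"
proof
  show "MG_theorem A \<phi>" if "MG_derives A {} \<phi>"
    using that by induction (auto intro: MG_theorem.MP)
qed (rule MG_derives.Theorem)

lemma MG_derives_axiom: "godel_dummett_axiom \<phi> \<Longrightarrow> MG_derives A \<Gamma> \<phi>"
  by (intro MG_derives.Theorem MG_theorem.Prop_Axiom)

lemma MG_derives_refl: "MG_derives A \<Gamma> (\<phi> \<^bold>\<rightarrow> \<phi>)"
  using MG_derives.MP[OF MG_derives.MP[OF MG_derives_axiom[OF S] MG_derives_axiom[OF K]]
      MG_derives_axiom[OF K[where \<psi> = \<phi>]]] .

text \<open>The deduction theorem holds because modus ponens is the only rule applied to premises;
  the modal rules are confined to \<open>MG_theorem\<close>.\<close>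

lemma MG_derives_impI:
  assumes "MG_derives A (insert \<phi> \<Gamma>) \<psi>"
  shows "MG_derives A \<Gamma> (\<phi> \<^bold>\<rightarrow> \<psi>)"
  using assms
proof induction
  case (Premise \<psi>)
  then show ?case
    using MG_derives.MP[OF MG_derives_axiom[OF K] MG_derives.Premise] MG_derives_refl by blast
next
  case (Theorem \<psi>)
  then show ?case
    by (rule MG_derives.MP[OF MG_derives_axiom[OF K] MG_derives.Theorem])
next
  case (MP \<psi> \<chi>)
  then show ?case
    using MG_derives.MP[OF MG_derives.MP[OF MG_derives_axiom[OF S]]] by blast
qed

lemma MG_theorem_impI: "MG_derives A {\<phi>} \<psi> \<Longrightarrow> MG_theorem A (\<phi> \<^bold>\<rightarrow> \<psi>)"
  using MG_derives_impI[of A \<phi> "{}"] by (simp add: MG_derives_empty_iff)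

lemma MG_derives_conjI:
  "MG_derives A \<Gamma> \<phi> \<Longrightarrow> MG_derives A \<Gamma> \<psi> \<Longrightarrow> MG_derives A \<Gamma> (\<phi> \<^bold>\<and> \<psi>)"
  using MG_derives.MP[OF MG_derives.MP[OF MG_derives_axiom[OF And_I]]] .

lemma MG_derives_conjD:
  assumes "MG_derives A \<Gamma> (\<phi> \<^bold>\<and> \<psi>)"
  shows "MG_derives A \<Gamma> \<phi>" "MG_derives A \<Gamma> \<psi>"
  using MG_derives.MP[OF MG_derives_axiom[OF And_E1] assms]
    MG_derives.MP[OF MG_derives_axiom[OF And_E2] assms] by blast+

definition linear_theory :: "fm set \<Rightarrow> fm set \<Rightarrow> bool" where
  "linear_theory A P \<longleftrightarrow>
    (\<forall>\<phi>. MG_derives A P \<phi> \<longrightarrow> \<phi> \<in> P) \<and> (\<forall>\<phi> \<psi>. \<phi> \<^bold>\<rightarrow> \<psi> \<in> P \<or> \<psi> \<^bold>\<rightarrow> \<phi> \<in> P)"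

lemma MG_derives_Union_chain:
  assumes "MG_derives A (\<Union>C) \<phi>" "C \<noteq> {}" "subset.chain X C"
  shows "\<exists>\<Delta>\<in>C. MG_derives A \<Delta> \<phi>"
  using assms(1)
proof induction
  case (MP \<phi> \<psi>)
  then obtain \<Delta>1 \<Delta>2 where \<Delta>: "\<Delta>1 \<in> C" "\<Delta>2 \<in> C"
    "MG_derives A \<Delta>1 (\<phi> \<^bold>\<rightarrow> \<psi>)" "MG_derives A \<Delta>2 \<phi>"
    by blast
  then have "\<Delta>1 \<subseteq> \<Delta>2 \<or> \<Delta>2 \<subseteq> \<Delta>1"
    using assms(3) unfolding subset_chain_def by blast
  then show ?case
    using \<Delta> MG_derives_mono MG_derives.MP by metis
qed (use assms(2) in \<open>auto intro: MG_derives.intros\<close>)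

text \<open>By Zorn there is a maximal \<open>P\<close> above \<open>\<Gamma>\<close> that does not
  derive \<open>\<phi>\<close>. Every formula outside \<open>P\<close> implies \<open>\<phi>\<close>
  over \<open>P\<close>, so if two opposite implications were both outside, prelinearity would
  derive \<open>\<phi>\<close>.\<close>

lemma linear_theory_extension:
  assumes "\<not> MG_derives A \<Gamma> \<phi>"
  shows "\<exists>P. linear_theory A P \<and> \<Gamma> \<subseteq> P \<and> \<phi> \<notin> P"
proof -
  define X where "X = {\<Delta>. \<Gamma> \<subseteq> \<Delta> \<and> \<not> MG_derives A \<Delta> \<phi>}"
  have "\<exists>P\<in>X. \<forall>Q\<in>X. P \<subseteq> Q \<longrightarrow> Q = P"
  proof (rule subset_Zorn_nonempty)
    show "X \<noteq> {}"
      using assms unfolding X_def by blast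
    show "\<Union>C \<in> X" if "C \<noteq> {}" "subset.chain X C" for C
    proof -
      have C: "\<Gamma> \<subseteq> \<Delta> \<and> \<not> MG_derives A \<Delta> \<phi>" if "\<Delta> \<in> C" for \<Delta>
        using that \<open>subset.chain X C\<close> unfolding X_def subset_chain_def by blast
      then have "\<not> MG_derives A (\<Union>C) \<phi>"
        using MG_derives_Union_chain[OF _ that] by blast
      moreover have "\<Gamma> \<subseteq> \<Union>C"
        using C \<open>C \<noteq> {}\<close> by blast
      ultimately show ?thesis
        unfolding X_def by blast
    qed
  qed
  then obtain P where P: "P \<in> X" and max: "\<And>Q. Q \<in> X \<Longrightarrow> P \<subseteq> Q \<Longrightarrow> Q = P"
    by blast
  have ext: "MG_derives A P (\<psi> \<^bold>\<rightarrow> \<phi>)" if "\<psi> \<notin> P" for \<psi>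
    using that max[of "insert \<psi> P"] P MG_derives_impI unfolding X_def by blast
  have closed: "\<psi> \<in> P" if "MG_derives A P \<psi>" for \<psi>
    using ext[of \<psi>] that P MG_derives.MP unfolding X_def by blast
  have "\<psi> \<^bold>\<rightarrow> \<chi> \<in> P \<or> \<chi> \<^bold>\<rightarrow> \<psi> \<in> P" for \<psi> \<chi>
  proof (rule ccontr)
    assume "\<not> ?thesis"
    then have "MG_derives A P ((\<psi> \<^bold>\<rightarrow> \<chi>) \<^bold>\<rightarrow> \<phi>)" "MG_derives A P ((\<chi> \<^bold>\<rightarrow> \<psi>) \<^bold>\<rightarrow> \<phi>)"
      using ext by auto
    then have "MG_derives A P \<phi>"
      using MG_derives.MP[OF MG_derives.MP[OF MG_derives.MP[OF MG_derives_axiom[OF Or_E]]]]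
        MG_derives_axiom[OF Prelinearity] by blast
    then show False
      using P unfolding X_def by blast
  qed
  then have "linear_theory A P"
    unfolding linear_theory_def using closed by blast
  moreover have "\<Gamma> \<subseteq> P" "\<phi> \<notin> P"
    using P MG_derives.Premise unfolding X_def by blast+
  ultimately show ?thesis
    by blast
qed

context
  fixes A P
  assumes P: "linear_theory A P"
begin

lemma linear_theory_closed: "MG_derives A P \<phi> \<Longrightarrow> \<phi> \<in> P"
  using P unfolding linear_theory_def by blast

lemma linear_theory_theorem: "MG_theorem A \<phi> \<Longrightarrow> \<phi> \<in> P"
  by (intro linear_theory_closed MG_derives.Theorem)

lemma linear_theory_axiom: "godel_dummett_axiom \<phi> \<Longrightarrow> \<phi> \<in> P"
  by (intro linear_theory_theorem MG_theorem.Prop_Axiom)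

lemma linear_theory_mp: "\<phi> \<^bold>\<rightarrow> \<psi> \<in> P \<Longrightarrow> \<phi> \<in> P \<Longrightarrow> \<psi> \<in> P"
  by (rule linear_theory_closed[OF MG_derives.MP]) (auto intro: MG_derives.Premise)

lemma linear_theory_total: "\<phi> \<^bold>\<rightarrow> \<psi> \<in> P \<or> \<psi> \<^bold>\<rightarrow> \<phi> \<in> P"
  using P unfolding linear_theory_def by blast

lemma linear_theory_weaken: "\<psi> \<in> P \<Longrightarrow> \<phi> \<^bold>\<rightarrow> \<psi> \<in> P"
  by (rule linear_theory_mp[OF linear_theory_axiom[OF K]])

lemma linear_theory_refl: "\<phi> \<^bold>\<rightarrow> \<phi> \<in> P"
  by (rule linear_theory_closed[OF MG_derives_refl])

lemma linear_theory_S: "\<phi> \<^bold>\<rightarrow> \<psi> \<^bold>\<rightarrow> \<chi> \<in> P \<Longrightarrow> \<phi> \<^bold>\<rightarrow> \<psi> \<in> P \<Longrightarrow> \<phi> \<^bold>\<rightarrow> \<chi> \<in> P"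
  by (rule linear_theory_mp[OF linear_theory_mp[OF linear_theory_axiom[OF S]]])

lemma linear_theory_trans: "\<phi> \<^bold>\<rightarrow> \<psi> \<in> P \<Longrightarrow> \<psi> \<^bold>\<rightarrow> \<chi> \<in> P \<Longrightarrow> \<phi> \<^bold>\<rightarrow> \<chi> \<in> P"
  by (rule linear_theory_S[OF linear_theory_weaken])

lemma linear_theory_conj_greatest:
  "\<chi> \<^bold>\<rightarrow> \<phi> \<in> P \<Longrightarrow> \<chi> \<^bold>\<rightarrow> \<psi> \<in> P \<Longrightarrow> \<chi> \<^bold>\<rightarrow> \<phi> \<^bold>\<and> \<psi> \<in> P"
  by (rule linear_theory_S[OF linear_theory_trans[OF _ linear_theory_axiom[OF And_I]]])

lemma linear_theory_disj_least:
  "\<phi> \<^bold>\<rightarrow> \<chi> \<in> P \<Longrightarrow> \<psi> \<^bold>\<rightarrow> \<chi> \<in> P \<Longrightarrow> \<phi> \<^bold>\<or> \<psi> \<^bold>\<rightarrow> \<chi> \<in> P"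
  using linear_theory_mp[OF linear_theory_mp[OF linear_theory_axiom[OF Or_E]]] .

lemma linear_theory_imp_collapse:
  assumes "\<phi> \<^bold>\<rightarrow> \<psi> \<notin> P"
  shows "(\<phi> \<^bold>\<rightarrow> \<psi>) \<^bold>\<rightarrow> \<psi> \<in> P"
proof -
  have "\<phi> \<^bold>\<rightarrow> \<phi> \<^bold>\<rightarrow> \<psi> \<notin> P"
    using assms linear_theory_S[OF _ linear_theory_refl] by blast
  then have "(\<phi> \<^bold>\<rightarrow> \<psi>) \<^bold>\<rightarrow> \<phi> \<in> P"
    using linear_theory_total by blast
  then show ?thesis
    by (rule linear_theory_S[OF linear_theory_refl])
qed

end


section \<open>Valuations satisfying all theorems\<close>

definition MG_valuation :: "fm set \<Rightarrow> (fm \<Rightarrow> real) \<Rightarrow> bool" where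
  "MG_valuation A v \<longleftrightarrow>
    (\<forall>\<phi>. 0 \<le> v \<phi> \<and> v \<phi> \<le> 1) \<and> v \<^bold>\<bottom> = 0 \<and>
    (\<forall>\<phi> \<psi>. v (\<phi> \<^bold>\<and> \<psi>) = min (v \<phi>) (v \<psi>)) \<and>
    (\<forall>\<phi> \<psi>. v (\<phi> \<^bold>\<or> \<psi>) = max (v \<phi>) (v \<psi>)) \<and>
    (\<forall>\<phi> \<psi>. v (\<phi> \<^bold>\<rightarrow> \<psi>) = godel_imp (v \<phi>) (v \<psi>)) \<and>
    (\<forall>\<phi>. MG_theorem A \<phi> \<longrightarrow> v \<phi> = 1)"

lemma MG_valuationD:
  assumes "MG_valuation A v"
  shows "0 \<le> v \<phi>" "v \<phi> \<le> 1" "v \<^bold>\<bottom> = 0" "v (\<phi> \<^bold>\<and> \<psi>) = min (v \<phi>) (v \<psi>)"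
    "v (\<phi> \<^bold>\<or> \<psi>) = max (v \<phi>) (v \<psi>)" "v (\<phi> \<^bold>\<rightarrow> \<psi>) = godel_imp (v \<phi>) (v \<psi>)"
    "MG_theorem A \<phi> \<Longrightarrow> v \<phi> = 1"
  using assms unfolding MG_valuation_def by blast+

text \<open>The operations of a Goedel chain are determined by its order and endpoints, so any order
  embedding of the chain of \<open>P\<close> that sends the endpoints to 0 and 1 is a
  homomorphism.\<close>

lemma MG_valuation_of_linear_theory:
  assumes P: "linear_theory A P" and w: "\<And>\<phi> \<psi>. w \<phi> \<le> w \<psi> \<longleftrightarrow> \<phi> \<^bold>\<rightarrow> \<psi> \<in> P"
    and bot: "w \<^bold>\<bottom> = 0" and top: "w (\<^bold>\<not> \<^bold>\<bottom>) = 1"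
  shows "MG_valuation A w" "w \<phi> = 1 \<longleftrightarrow> \<phi> \<in> P"
proof -
  note ax = linear_theory_axiom[OF P]
  have le1: "w \<phi> \<le> 1" for \<phi>
    using w[of \<phi> "\<^bold>\<not> \<^bold>\<bottom>"] top linear_theory_weaken[OF P linear_theory_refl[OF P]] by simp
  have ge0: "0 \<le> w \<phi>" for \<phi>
    using w[of "\<^bold>\<bottom>" \<phi>] bot ax[OF Bot_E] by simp
  show eq1: "w \<phi> = 1 \<longleftrightarrow> \<phi> \<in> P" for \<phi>
  proof -
    have "1 \<le> w \<phi> \<longleftrightarrow> \<^bold>\<not> \<^bold>\<bottom> \<^bold>\<rightarrow> \<phi> \<in> P"
      using w[of "\<^bold>\<not> \<^bold>\<bottom>" \<phi>] top by simp
    also have "\<dots> \<longleftrightarrow> \<phi> \<in> P"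
      using linear_theory_weaken[OF P] linear_theory_mp[OF P _ linear_theory_refl[OF P]] by blast
    finally show ?thesis
      using le1[of \<phi>] by auto
  qed
  have "w (\<phi> \<^bold>\<and> \<psi>) = min (w \<phi>) (w \<psi>)" for \<phi> \<psi>
  proof (rule antisym)
    show "w (\<phi> \<^bold>\<and> \<psi>) \<le> min (w \<phi>) (w \<psi>)"
      using w ax[OF And_E1] ax[OF And_E2] by simp
    show "min (w \<phi>) (w \<psi>) \<le> w (\<phi> \<^bold>\<and> \<psi>)"
      using w linear_theory_conj_greatest[OF P, of _ \<phi> \<psi>] linear_theory_refl[OF P]
        linear_theory_total[OF P, of \<phi> \<psi>] by (auto simp: min_le_iff_disj)
  qed
  moreover have "w (\<phi> \<^bold>\<or> \<psi>) = max (w \<phi>) (w \<psi>)" for \<phi> \<psi>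
  proof (rule antisym)
    show "max (w \<phi>) (w \<psi>) \<le> w (\<phi> \<^bold>\<or> \<psi>)"
      using w ax[OF Or_I1] ax[OF Or_I2] by simp
    show "w (\<phi> \<^bold>\<or> \<psi>) \<le> max (w \<phi>) (w \<psi>)"
      using w linear_theory_disj_least[OF P, of \<phi> _ \<psi>] linear_theory_refl[OF P]
        linear_theory_total[OF P, of \<phi> \<psi>] by (auto simp: le_max_iff_disj)
  qed
  moreover have "w (\<phi> \<^bold>\<rightarrow> \<psi>) = godel_imp (w \<phi>) (w \<psi>)" for \<phi> \<psi>
  proof (cases "\<phi> \<^bold>\<rightarrow> \<psi> \<in> P")
    case False
    then have "w (\<phi> \<^bold>\<rightarrow> \<psi>) = w \<psi>"
      using w linear_theory_imp_collapse[OF P] ax[OF K] by (intro antisym) auto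
    then show ?thesis
      using False w by (simp add: godel_imp_def)
  qed (use eq1 w in \<open>auto simp: godel_imp_def\<close>)
  ultimately show "MG_valuation A w"
    unfolding MG_valuation_def
    using le1 ge0 bot eq1 linear_theory_theorem[OF P] by blast
qed

context
  fixes A v
  assumes v: "MG_valuation A v"
begin

lemma MG_valuation_mono: "MG_theorem A (\<phi> \<^bold>\<rightarrow> \<psi>) \<Longrightarrow> v \<phi> \<le> v \<psi>"
  using MG_valuationD(7)[OF v, of "\<phi> \<^bold>\<rightarrow> \<psi>"] MG_valuationD(1,2)[OF v]
  unfolding MG_valuationD(6)[OF v] godel_imp_def by (metis order.refl linear)

lemma MG_valuation_modal_axiom: "modal_axiom (\<phi> \<^bold>\<rightarrow> \<psi>) \<Longrightarrow> v \<phi> \<le> v \<psi>"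
  by (intro MG_valuation_mono MG_theorem.Modal_Axiom)

lemma MG_valuation_box_theorem: "MG_theorem A \<phi> \<Longrightarrow> v (\<^bold>\<box> \<phi>) = 1"
  by (intro MG_valuationD(7)[OF v] MG_theorem.Nec_Box)

lemma MG_valuation_box_mono:
  assumes "MG_theorem A (\<phi> \<^bold>\<rightarrow> \<psi>)"
  shows "v (\<^bold>\<box> \<phi>) \<le> v (\<^bold>\<box> \<psi>)"
proof -
  have "MG_theorem A (\<^bold>\<box> \<phi> \<^bold>\<rightarrow> \<^bold>\<box> \<psi>)"
    using MG_theorem.MP[OF MG_theorem.Modal_Axiom[OF K_Box] MG_theorem.Nec_Box[OF assms]] .
  then show ?thesis
    by (rule MG_valuation_mono)
qed

lemma MG_valuation_dia_mono: "MG_theorem A (\<phi> \<^bold>\<rightarrow> \<psi>) \<Longrightarrow> v (\<^bold>\<diamond> \<phi>) \<le> v (\<^bold>\<diamond> \<psi>)"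
  by (intro MG_valuation_mono MG_theorem.Mon_Dia)

lemma MG_valuation_box_conj: "v (\<^bold>\<box> (\<phi> \<^bold>\<and> \<psi>)) = min (v (\<^bold>\<box> \<phi>)) (v (\<^bold>\<box> \<psi>))"
proof (rule antisym)
  show "v (\<^bold>\<box> (\<phi> \<^bold>\<and> \<psi>)) \<le> min (v (\<^bold>\<box> \<phi>)) (v (\<^bold>\<box> \<psi>))"
    using MG_valuation_box_mono[OF MG_theorem.Prop_Axiom] And_E1 And_E2 by simp
  have "v (\<^bold>\<box> \<phi>) \<le> v (\<^bold>\<box> (\<psi> \<^bold>\<rightarrow> \<phi> \<^bold>\<and> \<psi>))"
    using MG_valuation_box_mono[OF MG_theorem.Prop_Axiom[OF And_I]] .
  also have "\<dots> \<le> godel_imp (v (\<^bold>\<box> \<psi>)) (v (\<^bold>\<box> (\<phi> \<^bold>\<and> \<psi>)))"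
    using MG_valuation_modal_axiom[OF K_Box, of \<psi> "\<phi> \<^bold>\<and> \<psi>"] MG_valuationD(6)[OF v] by simp
  finally show "min (v (\<^bold>\<box> \<phi>)) (v (\<^bold>\<box> \<psi>)) \<le> v (\<^bold>\<box> (\<phi> \<^bold>\<and> \<psi>))"
    by (auto simp: godel_imp_def split: if_splits)
qed

lemma MG_valuation_dia_bot: "v (\<^bold>\<diamond> \<^bold>\<bottom>) = 0"
  using MG_valuation_modal_axiom[OF F_Dia] MG_valuationD(1)[OF v, of "\<^bold>\<diamond> \<^bold>\<bottom>"] MG_valuationD(3)[OF v]
  by simp

lemma MG_valuation_box_imp:
  assumes "v (\<^bold>\<diamond> \<phi>) \<le> v (\<^bold>\<box> \<psi>)"
  shows "v (\<^bold>\<box> (\<phi> \<^bold>\<rightarrow> \<psi>)) = 1"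
  using MG_valuation_modal_axiom[OF FS2, of \<phi> \<psi>] assms MG_valuationD(2)[OF v, of "\<^bold>\<box> (\<phi> \<^bold>\<rightarrow> \<psi>)"]
  by (simp add: MG_valuationD(6)[OF v] godel_imp_def)

text \<open>Here \<open>\<theta> = (\<psi> \<rightarrow> \<phi>) \<rightarrow> \<phi>\<close> says that \<open>\<phi>\<close> lies strictly below \<open>\<psi>\<close> (or is true). By FS1,
  \<open>\<diamond>(\<psi> \<rightarrow> \<phi>) \<le> (\<box>\<psi> \<rightarrow> \<diamond>\<phi>) = \<diamond>\<phi> < \<box>\<psi> \<le> \<box>\<theta>\<close>, so \<open>\<box>((\<psi> \<rightarrow> \<phi>) \<rightarrow> \<theta>)\<close> holds by FS2; and
  \<open>(\<psi> \<rightarrow> \<phi>) \<rightarrow> \<theta>\<close> is equivalent to \<open>\<theta>\<close>.\<close>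

lemma MG_valuation_box_less:
  assumes "v (\<^bold>\<diamond> \<phi>) < v (\<^bold>\<box> \<psi>)"
  shows "v (\<^bold>\<box> ((\<psi> \<^bold>\<rightarrow> \<phi>) \<^bold>\<rightarrow> \<phi>)) = 1"
proof -
  let ?\<theta> = "(\<psi> \<^bold>\<rightarrow> \<phi>) \<^bold>\<rightarrow> \<phi>"
  have "v (\<^bold>\<diamond> (\<psi> \<^bold>\<rightarrow> \<phi>)) \<le> godel_imp (v (\<^bold>\<box> \<psi>)) (v (\<^bold>\<diamond> \<phi>))"
    using MG_valuation_modal_axiom[OF FS1, of \<psi> \<phi>] MG_valuationD(6)[OF v] by simp
  also have "\<dots> = v (\<^bold>\<diamond> \<phi>)"
    using assms by (simp add: godel_imp_def)
  also have "\<dots> \<le> v (\<^bold>\<box> \<psi>)"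
    using assms by simp
  also have "\<dots> \<le> v (\<^bold>\<box> ?\<theta>)"
  proof (rule MG_valuation_box_mono, rule MG_theorem_impI, rule MG_derives_impI)
    show "MG_derives A {\<psi> \<^bold>\<rightarrow> \<phi>, \<psi>} \<phi>"
      by (rule MG_derives.MP[of _ _ \<psi>]) (auto intro: MG_derives.Premise)
  qed
  finally have "v (\<^bold>\<box> ((\<psi> \<^bold>\<rightarrow> \<phi>) \<^bold>\<rightarrow> ?\<theta>)) = 1"
    by (rule MG_valuation_box_imp)
  moreover have "v (\<^bold>\<box> ((\<psi> \<^bold>\<rightarrow> \<phi>) \<^bold>\<rightarrow> ?\<theta>)) \<le> v (\<^bold>\<box> ?\<theta>)"
  proof (rule MG_valuation_box_mono, rule MG_theorem_impI, rule MG_derives_impI)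
    show "MG_derives A {\<psi> \<^bold>\<rightarrow> \<phi>, (\<psi> \<^bold>\<rightarrow> \<phi>) \<^bold>\<rightarrow> ?\<theta>} \<phi>"
      by (rule MG_derives.MP[of _ _ "\<psi> \<^bold>\<rightarrow> \<phi>"], rule MG_derives.MP[of _ _ "\<psi> \<^bold>\<rightarrow> \<phi>"])
        (auto intro: MG_derives.Premise)
  qed
  ultimately show ?thesis
    using MG_valuationD(2)[OF v, of "\<^bold>\<box> ?\<theta>"] by simp
qed

end


section \<open>Order embeddings into the reals with finitely many interval constraints\<close>

text \<open>The sets \<open>L\<close> and \<open>U\<close> bound strictly, \<open>L'\<close> and
  \<open>U'\<close> weakly. Let \<open>m\<close> be the largest lower and \<open>k\<close> the
  smallest upper bound. If there is no gap between them, they coincide and both come from the weak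
  sets, so \<open>m\<close> itself is a solution.\<close>

lemma exists_between_finite_bounds:
  fixes L L' U U' :: "real set"
  assumes "finite L" "finite L'" "finite U" "finite U'"
    and "\<And>a b. a \<in> L \<Longrightarrow> b \<in> U \<Longrightarrow> a < b" "\<And>a b. a \<in> L \<Longrightarrow> b \<in> U' \<Longrightarrow> a < b"
    and "\<And>a b. a \<in> L' \<Longrightarrow> b \<in> U \<Longrightarrow> a < b" "\<And>a b. a \<in> L' \<Longrightarrow> b \<in> U' \<Longrightarrow> a \<le> b"
  shows "\<exists>y. (\<forall>a\<in>L. a < y) \<and> (\<forall>a\<in>L'. a \<le> y) \<and> (\<forall>b\<in>U. y < b) \<and> (\<forall>b\<in>U'. y \<le> b)"
proof -
  \<comment> \<open>The second property is an implication so that \<open>m\<close> exists, as an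
    arbitrary number, even without lower bounds; likewise for \<open>k\<close>.\<close>
  obtain m where m: "\<forall>a\<in>L \<union> L'. a \<le> m" "L \<union> L' \<noteq> {} \<longrightarrow> m \<in> L \<union> L'"
    using Max_ge[of "L \<union> L'"] Max_in[of "L \<union> L'"] assms(1,2) by (metis empty_iff finite_UnI)
  obtain k where k: "\<forall>b\<in>U \<union> U'. k \<le> b" "U \<union> U' \<noteq> {} \<longrightarrow> k \<in> U \<union> U'"
    using Min_le[of "U \<union> U'"] Min_in[of "U \<union> U'"] assms(3,4) by (metis empty_iff finite_UnI)
  consider "L \<union> L' = {}" | "U \<union> U' = {}" | "m < k" | "m \<in> L \<union> L'" "k \<in> U \<union> U'" "k \<le> m"
    using m(2) k(2) by linarith
  then show ?thesis
  proof cases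
    case 1
    then show ?thesis
      using k(1) by (intro exI[of _ "k - 1"]) (force intro: less_le_trans[of _ k])
  next
    case 2
    then show ?thesis
      using m(1) by (intro exI[of _ "m + 1"]) (force intro: le_less_trans[of _ m])
  next
    case 3
    then obtain y where "m < y" "y < k"
      using dense by blast
    then have "\<forall>a\<in>L \<union> L'. a < y" "\<forall>b\<in>U \<union> U'. y < b"
      using m(1) k(1) by force+
    then show ?thesis
      by (intro exI[of _ y]) (auto intro: less_imp_le)
  next
    case 4
    then have "m = k" "m \<in> L'" "k \<in> U'"
      using assms(5)[of m k] assms(6)[of m k] assms(7)[of m k] assms(8)[of m k] by fastforce+
    then show ?thesis
      using assms(6)[of _ k] assms(7)[of m] m(1) k(1) by (intro exI[of _ m]) simp
  qed
qed

text \<open>As in Cantor's argument, the elements are placed one at a time. The condition on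
  \<open>C\<close> is also forced by the conclusion: if \<open>c\<close> is at most
  \<open>d\<close>, then \<open>l\<close> \<le> \<open>g c\<close> \<le> \<open>g d\<close> \<le>
  \<open>u'\<close>, and strictly so if \<open>c\<close> is strictly below \<open>d\<close>, which
  is what \<open>\<not> le d c\<close> says.\<close>

lemma preorder_embedding_with_bounds:
  fixes le :: "'a::countable \<Rightarrow> 'a \<Rightarrow> bool" and C :: "('a \<times> real \<times> real) set"
  assumes total: "\<And>x y. le x y \<or> le y x"
    and transp: "transp le"
    and fin: "finite C"
    and bounds: "\<forall>(c, l, u)\<in>C. \<forall>(d, l', u')\<in>C. (le c d \<longrightarrow> l \<le> u') \<and> (\<not> le d c \<longrightarrow> l < u')"
  shows "\<exists>g :: 'a \<Rightarrow> real. (\<forall>x y. g x \<le> g y \<longleftrightarrow> le x y) \<and> (\<forall>c l u. (c, l, u) \<in> C \<longrightarrow> l \<le> g c \<and> g c \<le> u)"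
proof -
  \<comment> \<open>Besides being an embedding on \<open>S\<close>, the partial map respects what
    the constraints demand of points above or below a constrained point that may not have been
    placed yet. The strict clauses leave room for that point.\<close>
  define inv where "inv S g \<longleftrightarrow>
      (\<forall>x\<in>S. \<forall>y\<in>S. g x \<le> g y \<longleftrightarrow> le x y) \<and>
      (\<forall>x\<in>S. \<forall>(c, l, u)\<in>C.
        (le x c \<longrightarrow> g x \<le> u) \<and> (\<not> le c x \<longrightarrow> g x < u) \<and>
        (le c x \<longrightarrow> l \<le> g x) \<and> (\<not> le x c \<longrightarrow> l < g x))"
    for S and g :: "'a \<Rightarrow> real"
  have refl: "le x x" for x
    using total by blast
  have trans: "le x y \<Longrightarrow> le y z \<Longrightarrow> le x z" for x y z
    using transp by (rule transpD)
  have weak: "le c d \<Longrightarrow> l \<le> u'" and strict: "\<not> le d c \<Longrightarrow> l < u'"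
    if "(c, l, u) \<in> C" "(d, l', u') \<in> C" for c l u d l' u'
    using bounds that by auto
  have step: "\<exists>y. inv (insert x S) (g(x := y))" if S: "finite S" "inv S g" and x: "x \<notin> S" for S g x
  proof (cases "\<exists>a\<in>S. le a x \<and> le x a")
    case True
    then obtain a where a: "a \<in> S" "le a x" "le x a" by blast
    then have "le x z \<longleftrightarrow> le a z" "le z x \<longleftrightarrow> le z a" for z
      using trans by blast+
    then have "inv (insert x S) (g(x := g a))"
      using S(2) a(1) x unfolding inv_def by (auto simp: refl)
    then show ?thesis ..
  next
    case False
    \<comment> \<open>No placed point is equivalent to \<open>x\<close>, so placed points bound the
      new value strictly. A constrained point bounds it strictly if it lies strictly on one side of
      \<open>x\<close>, and weakly if it is comparable in the weak sense.\<close>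
    define L where "L = {g a |a. a \<in> S \<and> le a x} \<union> {l |c l u. (c, l, u) \<in> C \<and> \<not> le x c}"
    define L' where "L' = {l |c l u. (c, l, u) \<in> C \<and> le c x}"
    define U where "U = {g a |a. a \<in> S \<and> le x a} \<union> {u |c l u. (c, l, u) \<in> C \<and> \<not> le c x}"
    define U' where "U' = {u |c l u. (c, l, u) \<in> C \<and> le x c}"
    have g: "g a \<le> g b \<longleftrightarrow> le a b" if "a \<in> S" "b \<in> S" for a b
      using S(2) that unfolding inv_def by blast
    have gC: "le a c \<Longrightarrow> g a \<le> u" "\<not> le c a \<Longrightarrow> g a < u" "le c a \<Longrightarrow> l \<le> g a" "\<not> le a c \<Longrightarrow> l < g a"
      if "a \<in> S" "(c, l, u) \<in> C" for a c l u
      using S(2) that unfolding inv_def by blast+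
    have "L \<subseteq> g ` S \<union> (\<lambda>(c, l, u). l) ` C" "L' \<subseteq> (\<lambda>(c, l, u). l) ` C"
      "U \<subseteq> g ` S \<union> (\<lambda>(c, l, u). u) ` C" "U' \<subseteq> (\<lambda>(c, l, u). u) ` C"
      unfolding L_def L'_def U_def U'_def by force+
    then have fins: "finite L" "finite L'" "finite U" "finite U'"
      using S(1) fin by (meson finite_Un finite_imageI finite_subset)+
    have LU: "a < b" if "a \<in> L" "b \<in> U" for a b
    proof -
      from that consider
        (1) a' b' where "a = g a'" "a' \<in> S" "le a' x" "b = g b'" "b' \<in> S" "le x b'"
      | (2) a' d l u where "a = g a'" "a' \<in> S" "le a' x" "b = u" "(d, l, u) \<in> C" "\<not> le d x"
      | (3) c l u b' where "a = l" "(c, l, u) \<in> C" "\<not> le x c" "b = g b'" "b' \<in> S" "le x b'"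
      | (4) c l u d l' u' where "a = l" "(c, l, u) \<in> C" "\<not> le x c" "b = u'" "(d, l', u') \<in> C" "\<not> le d x"
        unfolding L_def U_def by blast
      then show ?thesis
      proof cases
        case 1
        then show ?thesis
          using False g[of b' a'] trans[of x b' a'] by fastforce
      next
        case 2
        then show ?thesis
          using gC(2)[of a' d l u] trans[of d a' x] by blast
      next
        case 3
        then show ?thesis
          using gC(4)[of b' c l u] trans[of x b' c] by blast
      next
        case 4
        then show ?thesis
          using strict[of c l u d l' u'] trans[of d c x] total[of c x] by blast
      qed
    qed
    have LU': "a < b" if "a \<in> L" "b \<in> U'" for a b
    proof -
      from that consider
        (1) a' d l u where "a = g a'" "a' \<in> S" "le a' x" "b = u" "(d, l, u) \<in> C" "le x d"
      | (2) c l u d l' u' where "a = l" "(c, l, u) \<in> C" "\<not> le x c" "b = u'" "(d, l', u') \<in> C" "le x d"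
        unfolding L_def U'_def by blast
      then show ?thesis
      proof cases
        case 1
        then show ?thesis
          using False gC(2)[of a' d l u] trans[of x d a'] by blast
      next
        case 2
        then show ?thesis
          using strict[of c l u d l' u'] trans[of x d c] by blast
      qed
    qed
    have L'U: "a < b" if "a \<in> L'" "b \<in> U" for a b
    proof -
      from that consider
        (1) c l u b' where "a = l" "(c, l, u) \<in> C" "le c x" "b = g b'" "b' \<in> S" "le x b'"
      | (2) c l u d l' u' where "a = l" "(c, l, u) \<in> C" "le c x" "b = u'" "(d, l', u') \<in> C" "\<not> le d x"
        unfolding L'_def U_def by blast
      then show ?thesis
      proof cases
        case 1
        then show ?thesis
          using False gC(4)[of b' c l u] trans[of b' c x] by blast
      next
        case 2
        then show ?thesis
          using strict[of c l u d l' u'] trans[of d c x] by blast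
      qed
    qed
    have L'U': "a \<le> b" if "a \<in> L'" "b \<in> U'" for a b
    proof -
      from that obtain c l u d l' u'
        where "a = l" "(c, l, u) \<in> C" "le c x" "b = u'" "(d, l', u') \<in> C" "le x d"
        unfolding L'_def U'_def by blast
      then show ?thesis
        using weak[of c l u d l' u'] trans[of c x d] by blast
    qed
    obtain y where y: "\<forall>a\<in>L. a < y" "\<forall>a\<in>L'. a \<le> y" "\<forall>b\<in>U. y < b" "\<forall>b\<in>U'. y \<le> b"
      using exists_between_finite_bounds[OF fins LU LU' L'U L'U'] by blast
    have yS: "le a x \<Longrightarrow> g a < y" "le x a \<Longrightarrow> y < g a" if "a \<in> S" for a
    proof -
      have "le a x \<Longrightarrow> g a \<in> L" "le x a \<Longrightarrow> g a \<in> U"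
        using that unfolding L_def U_def by blast+
      then show "le a x \<Longrightarrow> g a < y" "le x a \<Longrightarrow> y < g a"
        using y by simp_all
    qed
    have yC: "le x c \<Longrightarrow> y \<le> u" "\<not> le c x \<Longrightarrow> y < u" "le c x \<Longrightarrow> l \<le> y" "\<not> le x c \<Longrightarrow> l < y"
      if "(c, l, u) \<in> C" for c l u
    proof -
      have "le x c \<Longrightarrow> u \<in> U'" "\<not> le c x \<Longrightarrow> u \<in> U" "le c x \<Longrightarrow> l \<in> L'" "\<not> le x c \<Longrightarrow> l \<in> L"
        using that unfolding L_def L'_def U_def U'_def by blast+
      then show "le x c \<Longrightarrow> y \<le> u" "\<not> le c x \<Longrightarrow> y < u" "le c x \<Longrightarrow> l \<le> y" "\<not> le x c \<Longrightarrow> l < y"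
        using y by simp_all
    qed
    have "inv (insert x S) (g(x := y))"
      unfolding inv_def
    proof (intro conjI ballI)
      have yS': "g a \<le> y \<longleftrightarrow> le a x" "y \<le> g a \<longleftrightarrow> le x a" if "a \<in> S" for a
        using yS[OF that] total[of a x] by linarith+
      fix a b assume "a \<in> insert x S" "b \<in> insert x S"
      then show "(g(x := y)) a \<le> (g(x := y)) b \<longleftrightarrow> le a b"
        using g yS' refl by simp metis
    next
      fix a p assume "a \<in> insert x S" "p \<in> C"
      then show "case p of (c, l, u) \<Rightarrow>
        (le a c \<longrightarrow> (g(x := y)) a \<le> u) \<and> (\<not> le c a \<longrightarrow> (g(x := y)) a < u) \<and>
        (le c a \<longrightarrow> l \<le> (g(x := y)) a) \<and> (\<not> le a c \<longrightarrow> l < (g(x := y)) a)"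
        using x yC gC by (cases p) auto
    qed
    then show ?thesis ..
  qed
  \<comment> \<open>The stages follow the codes. Since \<open>to_nat\<close> need not be onto, a
    stage may add no element.\<close>
  define S where "S n = {x::'a. to_nat x < n}" for n
  have fin_S: "finite (S n)" for n
    unfolding S_def by (rule finite_imageD[of to_nat]) (auto intro: finite_subset[of _ "{..<n}"] inj_onI)
  have "\<exists>G. \<forall>n. inv (S n) (G n) \<and> (\<forall>x\<in>S n. G (Suc n) x = G n x)"
  proof (rule dependent_nat_choice)
    show "\<exists>g. inv (S 0) g"
      unfolding inv_def S_def by simp
    fix g n assume g: "inv (S n) g"
    show "\<exists>g'. inv (S (Suc n)) g' \<and> (\<forall>x\<in>S n. g' x = g x)"
    proof (cases "\<exists>x::'a. to_nat x = n")
      case True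
      then obtain x :: 'a where x: "to_nat x = n" by blast
      then have "S (Suc n) = insert x (S n)" "x \<notin> S n"
        unfolding S_def by (auto simp: less_Suc_eq)
      then show ?thesis
        using step[OF fin_S g] by fastforce
    next
      case False
      then have "S (Suc n) = S n"
        unfolding S_def by (auto simp: less_Suc_eq)
      then show ?thesis
        using g by auto
    qed
  qed
  then obtain G where G: "\<And>n. inv (S n) (G n)" "\<And>n x. x \<in> S n \<Longrightarrow> G (Suc n) x = G n x"
    by blast
  \<comment> \<open>The stage \<open>Suc (to_nat x)\<close> is the first one that contains
    \<open>x\<close>, and the value of \<open>x\<close> never changes afterwards.\<close>
  define g where "g x = G (Suc (to_nat x)) x" for x
  have stable: "G (Suc (to_nat x) + k) x = g x" for x k
  proof (induction k)
    case (Suc k)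
    have "x \<in> S (Suc (to_nat x) + k)"
      unfolding S_def by simp
    then show ?case
      using G(2) Suc by simp
  qed (simp add: g_def)
  then have g_eq: "g x = G n x" if "x \<in> S n" for x n
    using that stable[of x "n - Suc (to_nat x)"] unfolding S_def by simp
  show ?thesis
  proof (intro exI[of _ g] conjI allI impI)
    fix x y :: 'a
    have "x \<in> S (Suc (to_nat x + to_nat y))" "y \<in> S (Suc (to_nat x + to_nat y))"
      unfolding S_def by auto
    then show "g x \<le> g y \<longleftrightarrow> le x y"
      using G(1)[of "Suc (to_nat x + to_nat y)"] g_eq unfolding inv_def by simp
  next
    fix c l u assume c: "(c, l, u) \<in> C"
    have "c \<in> S (Suc (to_nat c))"
      unfolding S_def by simp
    then have "l \<le> g c \<and> g c \<le> u"
      using G(1)[of "Suc (to_nat c)"] g_eq c refl unfolding inv_def by fastforce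
    then show "l \<le> g c" "g c \<le> u"
      by simp_all
  qed
qed


section \<open>Witnessing one modal formula\<close>

instance fm :: countable
  by countable_datatype

lemma linear_theory_embedding:
  assumes P: "linear_theory A P" and "finite C"
    and "\<forall>(\<phi>, l, u)\<in>C. \<forall>(\<psi>, l', u')\<in>C.
      (\<phi> \<^bold>\<rightarrow> \<psi> \<in> P \<longrightarrow> l \<le> u') \<and> (\<psi> \<^bold>\<rightarrow> \<phi> \<notin> P \<longrightarrow> l < u')"
    and "(\<^bold>\<bottom>, 0, 0) \<in> C" "(\<^bold>\<not> \<^bold>\<bottom>, 1, 1) \<in> C"
  shows "\<exists>w. MG_valuation A w \<and> (\<forall>\<phi> \<psi>. w \<phi> \<le> w \<psi> \<longleftrightarrow> \<phi> \<^bold>\<rightarrow> \<psi> \<in> P) \<and>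
    (\<forall>\<phi>. w \<phi> = 1 \<longleftrightarrow> \<phi> \<in> P) \<and> (\<forall>\<phi> l u. (\<phi>, l, u) \<in> C \<longrightarrow> l \<le> w \<phi> \<and> w \<phi> \<le> u)"
proof -
  have trans: "transp (\<lambda>\<phi> \<psi>. \<phi> \<^bold>\<rightarrow> \<psi> \<in> P)"
    using linear_theory_trans[OF P] by (rule transpI)
  obtain w :: "fm \<Rightarrow> real" where w: "\<forall>\<phi> \<psi>. w \<phi> \<le> w \<psi> \<longleftrightarrow> \<phi> \<^bold>\<rightarrow> \<psi> \<in> P"
    "\<forall>\<phi> l u. (\<phi>, l, u) \<in> C \<longrightarrow> l \<le> w \<phi> \<and> w \<phi> \<le> u"
    using preorder_embedding_with_bounds[where le = "\<lambda>\<phi> \<psi>. \<phi> \<^bold>\<rightarrow> \<psi> \<in> P",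
        OF linear_theory_total[OF P] trans assms(2,3)] by blast
  have "w \<^bold>\<bottom> = 0" "w (\<^bold>\<not> \<^bold>\<bottom>) = 1"
    using w(2) assms(4,5) by force+
  then show ?thesis
    using w MG_valuation_of_linear_theory[OF P, of w] by (intro exI[of _ w]) simp
qed

lemma linear_theory_valuation:
  assumes P: "linear_theory A P" and bot: "\<^bold>\<bottom> \<notin> P"
  shows "\<exists>w. MG_valuation A w \<and> (\<forall>\<phi>. w \<phi> = 1 \<longleftrightarrow> \<phi> \<in> P)"
proof -
  let ?C = "{(\<^bold>\<bottom>, 0, 0), (\<^bold>\<not> \<^bold>\<bottom>, 1, 1)} :: (fm \<times> real \<times> real) set"
  have "\<^bold>\<not> (\<^bold>\<not> \<^bold>\<bottom>) \<notin> P"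
    using bot linear_theory_mp[OF P _ linear_theory_refl[OF P]] by blast
  then have "\<forall>(\<phi>, l, u)\<in>?C. \<forall>(\<psi>, l', u')\<in>?C.
      (\<phi> \<^bold>\<rightarrow> \<psi> \<in> P \<longrightarrow> l \<le> u') \<and> (\<psi> \<^bold>\<rightarrow> \<phi> \<notin> P \<longrightarrow> l < u')"
    using linear_theory_refl[OF P] linear_theory_axiom[OF P Bot_E] by simp
  from linear_theory_embedding[OF P _ this] show ?thesis
    by blast
qed

text \<open>The common core of both witness constructions: \<open>\<kappa>\<close> will be
  \<open>\<phi>\<close> with \<open>a\<close> the value of \<open>Box \<phi>\<close> when a box is
  witnessed, and truth with \<open>a = 1\<close> for a diamond. Only formulas strictly below
  \<open>\<kappa>\<close> are confined between their box and diamond values; for the others the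
  choice of theory and degree is responsible. The work lies in checking that the intervals do not
  contradict the order given by \<open>P\<close>.\<close>

lemma child_valuation:
  assumes v: "MG_valuation A v" and P: "linear_theory A P" and bot: "\<^bold>\<bottom> \<notin> P"
    and box: "\<And>\<psi>. v (\<^bold>\<box> \<psi>) = 1 \<Longrightarrow> \<psi> \<in> P" and F: "finite F"
    and below: "\<And>\<psi>. \<kappa> \<^bold>\<rightarrow> \<psi> \<notin> P \<Longrightarrow> v (\<^bold>\<box> \<psi>) < a"
    and a: "0 \<le> a" "a \<le> 1" and top: "\<kappa> \<in> P \<longleftrightarrow> a = 1" and kbot: "\<kappa> \<^bold>\<rightarrow> \<^bold>\<bottom> \<in> P \<Longrightarrow> a = 0"
  shows "\<exists>w. MG_valuation A w \<and> (\<forall>\<phi> \<psi>. w \<phi> \<le> w \<psi> \<longleftrightarrow> \<phi> \<^bold>\<rightarrow> \<psi> \<in> P) \<and>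
    (\<forall>\<phi>. w \<phi> = 1 \<longleftrightarrow> \<phi> \<in> P) \<and> w \<kappa> = a \<and>
    (\<forall>\<psi>\<in>F. \<kappa> \<^bold>\<rightarrow> \<psi> \<notin> P \<longrightarrow> v (\<^bold>\<box> \<psi>) \<le> w \<psi> \<and> w \<psi> \<le> v (\<^bold>\<diamond> \<psi>))"
proof -
  define C where "C = {(\<^bold>\<bottom>, 0, 0), (\<^bold>\<not> \<^bold>\<bottom>, 1, 1), (\<kappa>, a, a)} \<union>
    (\<lambda>\<psi>. (\<psi>, v (\<^bold>\<box> \<psi>), v (\<^bold>\<diamond> \<psi>))) ` {\<psi> \<in> F. \<kappa> \<^bold>\<rightarrow> \<psi> \<notin> P}"
  have C: "\<phi> = \<^bold>\<bottom> \<and> l = 0 \<and> u = 0 \<or> \<phi> = \<^bold>\<not> \<^bold>\<bottom> \<and> l = 1 \<and> u = 1 \<or> \<phi> = \<kappa> \<and> l = a \<and> u = a \<or>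
      \<kappa> \<^bold>\<rightarrow> \<phi> \<notin> P \<and> l = v (\<^bold>\<box> \<phi>) \<and> u = v (\<^bold>\<diamond> \<phi>)" if "(\<phi>, l, u) \<in> C" for \<phi> l u
    using that unfolding C_def by auto
  have weak: "v (\<^bold>\<box> \<psi>) \<le> v (\<^bold>\<diamond> \<chi>)" if "\<psi> \<^bold>\<rightarrow> \<chi> \<in> P" "\<chi> \<notin> P" for \<psi> \<chi>
    using that box[OF MG_valuation_box_less[OF v]] linear_theory_mp[OF P] by (meson not_le)
  have strict: "v (\<^bold>\<box> \<psi>) < v (\<^bold>\<diamond> \<chi>)" if "\<chi> \<^bold>\<rightarrow> \<psi> \<notin> P" for \<psi> \<chi>
    using that box[OF MG_valuation_box_imp[OF v]] by (meson not_le)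
  have P_simps [simp]: "\<^bold>\<not> \<^bold>\<bottom> \<^bold>\<rightarrow> \<psi> \<in> P \<longleftrightarrow> \<psi> \<in> P" "\<psi> \<^bold>\<rightarrow> \<^bold>\<not> \<^bold>\<bottom> \<in> P" "\<^bold>\<bottom> \<^bold>\<rightarrow> \<psi> \<in> P" "\<psi> \<^bold>\<rightarrow> \<psi> \<in> P" for \<psi>
    using linear_theory_mp[OF P _ linear_theory_refl[OF P]] linear_theory_weaken[OF P]
      linear_theory_refl[OF P] linear_theory_axiom[OF P Bot_E] by blast+
  have notin: "\<psi> \<notin> P" if "\<kappa> \<^bold>\<rightarrow> \<psi> \<notin> P" for \<psi>
    using that linear_theory_weaken[OF P] by blast
  have cmp: "\<psi> \<^bold>\<rightarrow> \<kappa> \<in> P" if "\<kappa> \<^bold>\<rightarrow> \<psi> \<notin> P" for \<psi>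
    using that linear_theory_total[OF P] by blast
  note [simp] = bot MG_valuationD(1,2)[OF v] MG_valuation_dia_bot[OF v] a
  have C_weak: "l \<le> u'" if "(\<phi>, l, u) \<in> C" "(\<psi>, l', u') \<in> C" "\<phi> \<^bold>\<rightarrow> \<psi> \<in> P" for \<phi> \<psi> l u l' u'
    using C[OF that(1)] C[OF that(2)] that(3) top kbot notin weak[of \<phi> \<psi>] below[of \<phi>]
    by (elim disjE conjE) (auto simp: less_imp_le)
  have C_strict: "l < u'" if "(\<phi>, l, u) \<in> C" "(\<psi>, l', u') \<in> C" "\<psi> \<^bold>\<rightarrow> \<phi> \<notin> P" for \<phi> \<psi> l u l' u'
  proof -
    \<comment> \<open>Strict positivity comes from comparison with \<open>Box Bot\<close>, whose
      value is at least 0.\<close>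
    have "0 < a" if "\<kappa> \<^bold>\<rightarrow> \<^bold>\<bottom> \<notin> P"
      using below[OF that] MG_valuationD(1)[OF v, of "\<^bold>\<box> \<^bold>\<bottom>"] by linarith
    moreover have "0 < v (\<^bold>\<diamond> \<psi>)" if "\<psi> \<^bold>\<rightarrow> \<^bold>\<bottom> \<notin> P"
      using strict[OF that] MG_valuationD(1)[OF v, of "\<^bold>\<box> \<^bold>\<bottom>"] by linarith
    moreover have "a < 1" if "\<kappa> \<notin> P"
      using that top a by linarith
    moreover have "v (\<^bold>\<box> \<phi>) < 1" if "\<kappa> \<^bold>\<rightarrow> \<phi> \<notin> P"
      using below[OF that] a by linarith
    ultimately show ?thesis
      using C[OF that(1)] C[OF that(2)] that(3) strict[of \<psi> \<phi>] below[of \<phi>] cmp[of \<psi>]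
      by (elim disjE conjE) auto
  qed
  have "finite C" "(\<^bold>\<bottom>, 0, 0) \<in> C" "(\<^bold>\<not> \<^bold>\<bottom>, 1, 1) \<in> C"
    unfolding C_def using F by auto
  moreover have "\<forall>(\<phi>, l, u)\<in>C. \<forall>(\<psi>, l', u')\<in>C.
      (\<phi> \<^bold>\<rightarrow> \<psi> \<in> P \<longrightarrow> l \<le> u') \<and> (\<psi> \<^bold>\<rightarrow> \<phi> \<notin> P \<longrightarrow> l < u')"
    using C_weak C_strict by blast
  ultimately obtain w where w: "MG_valuation A w" "\<forall>\<phi> \<psi>. w \<phi> \<le> w \<psi> \<longleftrightarrow> \<phi> \<^bold>\<rightarrow> \<psi> \<in> P"
    "\<forall>\<phi>. w \<phi> = 1 \<longleftrightarrow> \<phi> \<in> P" "\<forall>\<phi> l u. (\<phi>, l, u) \<in> C \<longrightarrow> l \<le> w \<phi> \<and> w \<phi> \<le> u"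
    using linear_theory_embedding[OF P, of C] by blast
  have "w \<kappa> = a"
    using w(4)[rule_format, of \<kappa> a a] unfolding C_def by auto
  moreover have "v (\<^bold>\<box> \<psi>) \<le> w \<psi> \<and> w \<psi> \<le> v (\<^bold>\<diamond> \<psi>)" if "\<psi> \<in> F" "\<kappa> \<^bold>\<rightarrow> \<psi> \<notin> P" for \<psi>
    using w(4)[rule_format, of \<psi> "v (\<^bold>\<box> \<psi>)" "v (\<^bold>\<diamond> \<psi>)"] that unfolding C_def by auto
  ultimately show ?thesis
    using w(1-3) by blast
qed

text \<open>The first part is the residuated form of \<open>v (Box \<psi>)\<close> \<le>
  \<open>godel_imp r (w \<psi>)\<close>. With \<open>min\<close> on the left, both parts are plain
  order conditions on three values.\<close>

definition modal_compatible :: "(fm \<Rightarrow> real) \<Rightarrow> real \<Rightarrow> (fm \<Rightarrow> real) \<Rightarrow> fm \<Rightarrow> bool" where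
  "modal_compatible v r w \<psi> \<longleftrightarrow> min r (v (\<^bold>\<box> \<psi>)) \<le> w \<psi> \<and> min r (w \<psi>) \<le> v (\<^bold>\<diamond> \<psi>)"

text \<open>The axiom \<open>W\<^sub>\<box>\<close> is what allows the formulas \<open>\<phi> \<rightarrow> \<psi>\<close> with \<open>v (\<box>\<psi>) = v (\<box>\<phi>)\<close> to be added
  to the theory of the witnessing world, so that \<open>\<phi>\<close> gets exactly the value of \<open>\<box>\<phi>\<close> there.\<close>

lemma box_witness_theory:
  assumes v: "MG_valuation W_Box v" and a: "v (\<^bold>\<box> \<phi>) = a" "a < 1"
  shows "\<not> MG_derives W_Box ({\<psi>. a < v (\<^bold>\<box> \<psi>)} \<union> {\<phi> \<^bold>\<rightarrow> \<psi> |\<psi>. v (\<^bold>\<box> \<psi>) = a}) \<phi>"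
proof
  let ?\<Delta> = "{\<psi>. a < v (\<^bold>\<box> \<psi>)} \<union> {\<phi> \<^bold>\<rightarrow> \<psi> |\<psi>. v (\<^bold>\<box> \<psi>) = a}"
  have top: "a < v (\<^bold>\<box> (\<^bold>\<not> \<^bold>\<bottom>))"
    using MG_valuation_box_theorem[OF v, of "\<^bold>\<not> \<^bold>\<bottom>"] a(2) MG_derives_refl MG_derives_empty_iff by force
  \<comment> \<open>Finitely many premises of each kind merge into one: boxes distribute over
    conjunction, so the box of a conjunction stays above \<open>a\<close>, respectively equal to
    \<open>a\<close>.\<close>
  have fin: "\<exists>g \<psi>. a < v (\<^bold>\<box> g) \<and> v (\<^bold>\<box> \<psi>) = a \<and> MG_derives W_Box {g, \<phi> \<^bold>\<rightarrow> \<psi>} \<chi>"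
    if "MG_derives W_Box ?\<Delta> \<chi>" for \<chi>
    using that
  proof induction
    case (Premise \<chi>)
    then show ?case
    proof
      assume "\<chi> \<in> {\<psi>. a < v (\<^bold>\<box> \<psi>)}"
      then show ?thesis
        using a(1) by (intro exI[of _ \<chi>] exI[of _ \<phi>]) (auto intro: MG_derives.Premise)
    next
      assume "\<chi> \<in> {\<phi> \<^bold>\<rightarrow> \<psi> |\<psi>. v (\<^bold>\<box> \<psi>) = a}"
      then obtain \<psi> where "\<chi> = \<phi> \<^bold>\<rightarrow> \<psi>" "v (\<^bold>\<box> \<psi>) = a" by blast
      then show ?thesis
        using top by (intro exI[of _ "\<^bold>\<not> \<^bold>\<bottom>"] exI[of _ \<psi>]) (auto intro: MG_derives.Premise)
    qed
  next
    case (Theorem \<chi>)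
    then show ?case
      using top a(1) MG_derives.Theorem by blast
  next
    case (MP \<chi>1 \<chi>2)
    then obtain g \<psi> g' \<psi>' where gs: "a < v (\<^bold>\<box> g)" "v (\<^bold>\<box> \<psi>) = a" "a < v (\<^bold>\<box> g')" "v (\<^bold>\<box> \<psi>') = a"
      and d: "MG_derives W_Box {g, \<phi> \<^bold>\<rightarrow> \<psi>} (\<chi>1 \<^bold>\<rightarrow> \<chi>2)" "MG_derives W_Box {g', \<phi> \<^bold>\<rightarrow> \<psi>'} \<chi>1"
      by blast
    let ?H = "{g \<^bold>\<and> g', \<phi> \<^bold>\<rightarrow> \<psi> \<^bold>\<and> \<psi>'}"
    have H: "MG_derives W_Box ?H (g \<^bold>\<and> g')"
      by (auto intro: MG_derives.Premise)
    have "MG_derives W_Box (insert \<phi> ?H) (\<psi> \<^bold>\<and> \<psi>')"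
      by (rule MG_derives.MP[of _ _ \<phi>]) (auto intro: MG_derives.Premise)
    then have imp: "MG_derives W_Box ?H (\<phi> \<^bold>\<rightarrow> \<psi>)" "MG_derives W_Box ?H (\<phi> \<^bold>\<rightarrow> \<psi>')"
      using MG_derives_conjD MG_derives_impI by blast+
    have cut: "MG_derives W_Box ?H \<chi>" if "MG_derives W_Box {x, y} \<chi>"
      "MG_derives W_Box ?H x" "MG_derives W_Box ?H y" for x y \<chi>
    proof -
      have "MG_derives W_Box (insert x (insert y ?H)) \<chi>"
        using that(1) by (rule MG_derives_mono) auto
      then have "MG_derives W_Box ?H (y \<^bold>\<rightarrow> x \<^bold>\<rightarrow> \<chi>)"
        by (intro MG_derives_impI)
      then show ?thesis
        using that(2,3) MG_derives.MP by blast
    qed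
    have "MG_derives W_Box ?H \<chi>2"
      using MG_derives.MP[OF cut[OF d(1) MG_derives_conjD(1)[OF H] imp(1)]
          cut[OF d(2) MG_derives_conjD(2)[OF H] imp(2)]] .
    then show ?case
      using gs MG_valuation_box_conj[OF v]
      by (intro exI[of _ "g \<^bold>\<and> g'"] exI[of _ "\<psi> \<^bold>\<and> \<psi>'"]) simp
  qed
  assume "MG_derives W_Box ?\<Delta> \<phi>"
  then obtain g \<psi> where g: "a < v (\<^bold>\<box> g)" "v (\<^bold>\<box> \<psi>) = a" "MG_derives W_Box {g, \<phi> \<^bold>\<rightarrow> \<psi>} \<phi>"
    using fin by blast
  let ?y = "\<psi> \<^bold>\<and> \<phi>"
  let ?\<theta> = "((\<phi> \<^bold>\<rightarrow> ?y) \<^bold>\<rightarrow> ?y) \<^bold>\<and> (?y \<^bold>\<rightarrow> \<phi>)"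
  have "MG_derives W_Box {g} ?\<theta>"
  proof (intro MG_derives_conjI MG_derives_impI)
    let ?H = "{\<phi> \<^bold>\<rightarrow> ?y, g}"
    have "MG_derives W_Box (insert \<phi> ?H) ?y"
      by (rule MG_derives.MP[of _ _ \<phi>]) (auto intro: MG_derives.Premise)
    then have "MG_derives W_Box ?H (\<phi> \<^bold>\<rightarrow> \<psi>)"
      using MG_derives_conjD MG_derives_impI by blast
    moreover have "MG_derives W_Box ?H ((\<phi> \<^bold>\<rightarrow> \<psi>) \<^bold>\<rightarrow> \<phi>)"
      by (rule MG_derives_impI, rule MG_derives_mono[OF g(3)]) auto
    ultimately have \<phi>: "MG_derives W_Box ?H \<phi>" and "MG_derives W_Box ?H \<psi>"
      using MG_derives.MP by blast+
    then show "MG_derives W_Box ?H \<psi>" "MG_derives W_Box ?H \<phi>"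
      by blast+
    show "MG_derives W_Box {?y, g} \<phi>"
      by (rule MG_derives_conjD(2)[of _ _ \<psi>]) (auto intro: MG_derives.Premise)
  qed
  then have "v (\<^bold>\<box> g) \<le> v (\<^bold>\<box> ?\<theta>)"
    by (intro MG_valuation_box_mono[OF v] MG_theorem_impI)
  also have "\<dots> \<le> v ((\<^bold>\<box> \<phi> \<^bold>\<rightarrow> \<^bold>\<box> ?y) \<^bold>\<rightarrow> \<^bold>\<box> ?y)"
    by (intro MG_valuation_mono[OF v] MG_theorem.Extra_Axiom) (auto simp: W_Box_def)
  also have "\<dots> = a"
    using a g(2) by (simp add: MG_valuationD(6)[OF v] MG_valuation_box_conj[OF v] godel_imp_def)
  finally show False
    using g(1) by simp
qed

text \<open>Giving \<open>\<phi>\<close> the value \<open>a\<close> of its box and choosing any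
  degree above \<open>a\<close> makes the world a witness. Formulas strictly below
  \<open>\<phi>\<close> are compatible by \<open>child_valuation\<close>; for the others the degree
  must not exceed any diamond value above \<open>a\<close>, and finiteness of \<open>F\<close>
  leaves room for such a degree.\<close>

lemma box_child:
  assumes v: "MG_valuation W_Box v" and F: "finite F"
  shows "\<exists>r w. MG_valuation W_Box w \<and> 0 \<le> r \<and> r \<le> 1 \<and> (\<forall>\<psi>\<in>F. modal_compatible v r w \<psi>) \<and>
    v (\<^bold>\<box> \<phi>) = godel_imp r (w \<phi>)"
proof (cases "v (\<^bold>\<box> \<phi>) = 1")
  case True
  \<comment> \<open>With degree 0 the Goedel implication is 1 and compatibility is trivial, so any
    valuation serves, for instance \<open>v\<close>.\<close>
  then show ?thesis
    using v MG_valuationD(1)[OF v]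
    by (intro exI[of _ 0] exI[of _ v]) (simp add: godel_imp_def modal_compatible_def min_def)
next
  case False
  define a where "a = v (\<^bold>\<box> \<phi>)"
  have a: "0 \<le> a" "a < 1" "v (\<^bold>\<box> \<phi>) = a"
    using False MG_valuationD(1,2)[OF v, of "\<^bold>\<box> \<phi>"] unfolding a_def by auto
  obtain P where P: "linear_theory W_Box P" "\<phi> \<notin> P"
    and sub: "{\<psi>. a < v (\<^bold>\<box> \<psi>)} \<union> {\<phi> \<^bold>\<rightarrow> \<psi> |\<psi>. v (\<^bold>\<box> \<psi>) = a} \<subseteq> P"
    using linear_theory_extension[OF box_witness_theory[OF v a(3,2)]] by blast
  have box: "\<psi> \<in> P" if "a < v (\<^bold>\<box> \<psi>)" for \<psi>
    using sub that by blast
  have eq: "\<phi> \<^bold>\<rightarrow> \<psi> \<in> P" if "v (\<^bold>\<box> \<psi>) = a" for \<psi>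
    using sub that by blast
  have box1: "\<psi> \<in> P" if "v (\<^bold>\<box> \<psi>) = 1" for \<psi>
    using box that a(2) by simp
  have bot: "\<^bold>\<bottom> \<notin> P"
    using P linear_theory_mp[OF P(1) linear_theory_axiom[OF P(1) Bot_E]] by blast
  have below: "v (\<^bold>\<box> \<psi>) < a" if "\<phi> \<^bold>\<rightarrow> \<psi> \<notin> P" for \<psi>
    using that box[of \<psi>] eq[of \<psi>] linear_theory_weaken[OF P(1)] by (meson not_less_iff_gr_or_eq)
  have dia: "a \<le> v (\<^bold>\<diamond> \<psi>)" if "\<phi> \<^bold>\<rightarrow> \<psi> \<in> P" for \<psi>
  proof (rule ccontr)
    assume "\<not> a \<le> v (\<^bold>\<diamond> \<psi>)"
    then have "\<psi> \<in> P" "\<psi> \<^bold>\<rightarrow> \<phi> \<in> P"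
      using box1[OF MG_valuation_box_less[OF v, of \<psi> \<phi>]] box1[OF MG_valuation_box_imp[OF v, of \<psi> \<phi>]]
        linear_theory_mp[OF P(1) _ that] a(3) by auto
    then show False
      using P linear_theory_mp[OF P(1)] by blast
  qed
  have "\<phi> \<in> P \<longleftrightarrow> a = 1"
    using P(2) a(2) by simp
  moreover have "a = 0" if "\<phi> \<^bold>\<rightarrow> \<^bold>\<bottom> \<in> P"
    using dia[OF that] MG_valuation_dia_bot[OF v] a(1) by simp
  ultimately obtain w where w: "MG_valuation W_Box w" "\<forall>\<phi> \<psi>. w \<phi> \<le> w \<psi> \<longleftrightarrow> \<phi> \<^bold>\<rightarrow> \<psi> \<in> P"
    "\<forall>\<phi>. w \<phi> = 1 \<longleftrightarrow> \<phi> \<in> P" "w \<phi> = a"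
    "\<forall>\<psi>\<in>F. \<phi> \<^bold>\<rightarrow> \<psi> \<notin> P \<longrightarrow> v (\<^bold>\<box> \<psi>) \<le> w \<psi> \<and> w \<psi> \<le> v (\<^bold>\<diamond> \<psi>)"
    using child_valuation[OF v P(1) bot box1 F below a(1) less_imp_le[OF a(2)]] by blast
  \<comment> \<open>The least diamond value over \<open>F\<close> that exceeds \<open>a\<close>,
    capped by 1.\<close>
  define r where "r = Min (insert 1 {x \<in> (\<lambda>\<psi>. v (\<^bold>\<diamond> \<psi>)) ` F. a < x})"
  have r: "a < r" "r \<le> 1" "\<And>\<psi>. \<psi> \<in> F \<Longrightarrow> a < v (\<^bold>\<diamond> \<psi>) \<Longrightarrow> r \<le> v (\<^bold>\<diamond> \<psi>)"
    unfolding r_def using F a(2) by (auto intro: Min_le)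
  have "modal_compatible v r w \<psi>" if \<psi>: "\<psi> \<in> F" for \<psi>
  proof (cases "\<phi> \<^bold>\<rightarrow> \<psi> \<in> P")
    case False
    then show ?thesis
      using w(5) \<psi> unfolding modal_compatible_def by (auto simp: min_def)
  next
    case True
    have "v (\<^bold>\<box> \<psi>) \<le> w \<psi>"
    proof (cases "a < v (\<^bold>\<box> \<psi>)")
      case True
      then show ?thesis
        using box w(3)[rule_format, of \<psi>] MG_valuationD(2)[OF v] by simp
    next
      case False
      then show ?thesis
        using w(2)[rule_format, of \<phi> \<psi>] True w(4) by simp
    qed
    moreover have "min r (w \<psi>) \<le> v (\<^bold>\<diamond> \<psi>)"
    proof (cases "a < v (\<^bold>\<diamond> \<psi>)")
      case True
      then show ?thesis
        using r(3) \<psi> by (simp add: min_le_iff_disj)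
    next
      case False
      then have "w \<psi> \<le> a"
        using box1[OF MG_valuation_box_imp[OF v, of \<psi> \<phi>]] w(2)[rule_format, of \<psi> \<phi>] w(4) a(3) by simp
      then show ?thesis
        using dia[OF True] by (simp add: min_le_iff_disj)
    qed
    ultimately show ?thesis
      unfolding modal_compatible_def by (simp add: min_le_iff_disj)
  qed
  then show ?thesis
    using w(1,4) r a by (intro exI[of _ r] exI[of _ w]) (simp add: godel_imp_def)
qed

lemma dia_witness_theory:
  assumes v: "MG_valuation A v" and \<chi>: "v (\<^bold>\<diamond> \<chi>) < v (\<^bold>\<diamond> \<phi>)"
  shows "\<not> MG_derives A (insert \<phi> {\<psi>. v (\<^bold>\<diamond> \<phi>) \<le> v (\<^bold>\<box> \<psi>)}) \<chi>"
proof
  have fin: "\<exists>g. v (\<^bold>\<diamond> \<phi>) \<le> v (\<^bold>\<box> g) \<and> MG_derives A {g} \<chi>"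
    if "MG_derives A {\<psi>. v (\<^bold>\<diamond> \<phi>) \<le> v (\<^bold>\<box> \<psi>)} \<chi>" for \<chi>
    using that
  proof induction
    case (Premise \<chi>)
    then show ?case
      using MG_derives.Premise[of \<chi> "{\<chi>}"] by blast
  next
    case (Theorem \<chi>)
    then show ?case
      using MG_valuation_box_theorem[OF v] MG_valuationD(2)[OF v] MG_derives.Theorem by metis
  next
    case (MP \<chi>1 \<chi>2)
    then obtain g g' where g: "v (\<^bold>\<diamond> \<phi>) \<le> v (\<^bold>\<box> g)" "MG_derives A {g} (\<chi>1 \<^bold>\<rightarrow> \<chi>2)"
      "v (\<^bold>\<diamond> \<phi>) \<le> v (\<^bold>\<box> g')" "MG_derives A {g'} \<chi>1"
      by blast
    have H: "MG_derives A {g \<^bold>\<and> g'} (g \<^bold>\<and> g')"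
      by (auto intro: MG_derives.Premise)
    have "MG_derives A {g \<^bold>\<and> g'} \<chi>2"
      using MG_derives.MP[OF MG_derives.MP[OF MG_derives.Theorem[OF MG_theorem_impI[OF g(2)]] MG_derives_conjD(1)[OF H]]
          MG_derives.MP[OF MG_derives.Theorem[OF MG_theorem_impI[OF g(4)]] MG_derives_conjD(2)[OF H]]] .
    then show ?case
      using g(1,3) MG_valuation_box_conj[OF v] by (intro exI[of _ "g \<^bold>\<and> g'"]) simp
  qed
  assume "MG_derives A (insert \<phi> {\<psi>. v (\<^bold>\<diamond> \<phi>) \<le> v (\<^bold>\<box> \<psi>)}) \<chi>"
  then obtain g where g: "v (\<^bold>\<diamond> \<phi>) \<le> v (\<^bold>\<box> g)" "MG_derives A {g} (\<phi> \<^bold>\<rightarrow> \<chi>)"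
    using fin MG_derives_impI by blast
  have "MG_derives A {g, \<phi>} \<chi>"
    by (rule MG_derives.MP[OF MG_derives_mono[OF g(2)]]) (auto intro: MG_derives.Premise)
  then have "v (\<^bold>\<diamond> \<phi>) \<le> v (\<^bold>\<diamond> (g \<^bold>\<rightarrow> \<chi>))"
    by (intro MG_valuation_dia_mono[OF v] MG_theorem_impI MG_derives_impI)
  also have "\<dots> \<le> godel_imp (v (\<^bold>\<box> g)) (v (\<^bold>\<diamond> \<chi>))"
    using MG_valuation_modal_axiom[OF v FS1, of g \<chi>] MG_valuationD(6)[OF v] by simp
  also have "\<dots> = v (\<^bold>\<diamond> \<chi>)"
    using g(1) \<chi> by (simp add: godel_imp_def)
  finally show False
    using \<chi> by simp
qed

text \<open>The disjunction of the relevant members of \<open>F\<close> works, as diamonds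
  distribute over it. A theory that omits this one formula omits all of those members.\<close>

lemma finite_dia_bound:
  assumes v: "MG_valuation A v" and "finite F" and "0 < a"
  shows "\<exists>\<chi>. v (\<^bold>\<diamond> \<chi>) < a \<and> (\<forall>\<psi>\<in>F. v (\<^bold>\<diamond> \<psi>) < a \<longrightarrow> MG_theorem A (\<psi> \<^bold>\<rightarrow> \<chi>))"
  using assms(2)
proof induction
  case empty
  then show ?case
    using assms(3) MG_valuation_dia_bot[OF v] by (intro exI[of _ "\<^bold>\<bottom>"]) simp
next
  case (insert \<psi> F)
  then obtain \<chi> where \<chi>: "v (\<^bold>\<diamond> \<chi>) < a" "\<And>\<psi>. \<psi> \<in> F \<Longrightarrow> v (\<^bold>\<diamond> \<psi>) < a \<Longrightarrow> MG_theorem A (\<psi> \<^bold>\<rightarrow> \<chi>)"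
    by blast
  show ?case
  proof (cases "v (\<^bold>\<diamond> \<psi>) < a")
    case True
    have "v (\<^bold>\<diamond> (\<psi> \<^bold>\<or> \<chi>)) < a"
      using MG_valuation_modal_axiom[OF v D_Dia, of \<psi> \<chi>] True \<chi>(1) MG_valuationD(5)[OF v] by simp
    moreover have "MG_theorem A (\<psi>' \<^bold>\<rightarrow> \<psi> \<^bold>\<or> \<chi>)" if "MG_theorem A (\<psi>' \<^bold>\<rightarrow> \<chi>)" for \<psi>'
    proof (rule MG_theorem_impI)
      have "MG_derives A {\<psi>'} \<chi>"
        by (rule MG_derives.MP[OF MG_derives.Theorem[OF that]]) (auto intro: MG_derives.Premise)
      then show "MG_derives A {\<psi>'} (\<psi> \<^bold>\<or> \<chi>)"
        by (rule MG_derives.MP[OF MG_derives_axiom[OF Or_I2]])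
    qed
    ultimately show ?thesis
      using \<chi>(2) MG_theorem.Prop_Axiom[OF Or_I1] by (intro exI[of _ "\<psi> \<^bold>\<or> \<chi>"]) auto
  qed (use \<chi> in auto)
qed

text \<open>The witness makes \<open>\<phi>\<close> true and is accessible to degree
  \<open>a\<close>, the value of \<open>Dia \<phi>\<close>. Formulas outside \<open>P\<close> are
  compatible by \<open>child_valuation\<close>. A member of \<open>F\<close> in \<open>P\<close>
  gets value 1, so its diamond must be at least \<open>a\<close>; omitting \<open>\<chi>\<close>
  from \<open>P\<close> ensures this.\<close>

lemma dia_child:
  assumes v: "MG_valuation A v" and F: "finite F"
  shows "\<exists>r w. MG_valuation A w \<and> 0 \<le> r \<and> r \<le> 1 \<and> (\<forall>\<psi>\<in>F. modal_compatible v r w \<psi>) \<and>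
    v (\<^bold>\<diamond> \<phi>) = min r (w \<phi>)"
proof (cases "v (\<^bold>\<diamond> \<phi>) = 0")
  case True
  then show ?thesis
    using v MG_valuationD(1)[OF v]
    by (intro exI[of _ 0] exI[of _ v]) (simp add: modal_compatible_def min_def)
next
  case False
  define a where "a = v (\<^bold>\<diamond> \<phi>)"
  have a: "0 < a" "a \<le> 1" "v (\<^bold>\<diamond> \<phi>) = a"
    using False MG_valuationD(1,2)[OF v, of "\<^bold>\<diamond> \<phi>"] unfolding a_def by auto
  obtain \<chi> where \<chi>: "v (\<^bold>\<diamond> \<chi>) < a" "\<And>\<psi>. \<psi> \<in> F \<Longrightarrow> v (\<^bold>\<diamond> \<psi>) < a \<Longrightarrow> MG_theorem A (\<psi> \<^bold>\<rightarrow> \<chi>)"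
    using finite_dia_bound[OF v F a(1)] by blast
  obtain P where P: "linear_theory A P" "\<chi> \<notin> P" and sub: "insert \<phi> {\<psi>. a \<le> v (\<^bold>\<box> \<psi>)} \<subseteq> P"
    using linear_theory_extension[OF dia_witness_theory[OF v, of \<chi> \<phi>]] \<chi>(1) unfolding a_def by blast
  have box: "\<psi> \<in> P" if "a \<le> v (\<^bold>\<box> \<psi>)" for \<psi>
    using sub that by blast
  have box1: "\<psi> \<in> P" if "v (\<^bold>\<box> \<psi>) = 1" for \<psi>
    using box that a(2) by simp
  have bot: "\<^bold>\<bottom> \<notin> P"
    using P linear_theory_mp[OF P(1) linear_theory_axiom[OF P(1) Bot_E]] by blast
  have top: "\<^bold>\<not> \<^bold>\<bottom> \<in> P"
    by (rule linear_theory_refl[OF P(1)])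
  have below: "v (\<^bold>\<box> \<psi>) < 1" if "\<^bold>\<not> \<^bold>\<bottom> \<^bold>\<rightarrow> \<psi> \<notin> P" for \<psi>
    using that box[of \<psi>] linear_theory_weaken[OF P(1)] a(2) by (meson less_le_trans not_le)
  have "\<^bold>\<not> \<^bold>\<bottom> \<in> P \<longleftrightarrow> (1::real) = 1"
    using top by simp
  moreover have "(1::real) = 0" if "\<^bold>\<not> (\<^bold>\<not> \<^bold>\<bottom>) \<in> P"
    using linear_theory_mp[OF P(1) that top] bot by simp
  ultimately obtain w where w: "MG_valuation A w" "\<forall>\<phi>. w \<phi> = 1 \<longleftrightarrow> \<phi> \<in> P"
    "\<forall>\<psi>\<in>F. \<^bold>\<not> \<^bold>\<bottom> \<^bold>\<rightarrow> \<psi> \<notin> P \<longrightarrow> v (\<^bold>\<box> \<psi>) \<le> w \<psi> \<and> w \<psi> \<le> v (\<^bold>\<diamond> \<psi>)"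
    using child_valuation[OF v P(1) bot box1 F below zero_le_one order.refl] by blast
  have "modal_compatible v a w \<psi>" if \<psi>: "\<psi> \<in> F" for \<psi>
  proof (cases "\<psi> \<in> P")
    case False
    then have "\<^bold>\<not> \<^bold>\<bottom> \<^bold>\<rightarrow> \<psi> \<notin> P"
      using linear_theory_mp[OF P(1) _ top] by blast
    then show ?thesis
      using w(3) \<psi> unfolding modal_compatible_def by (auto simp: min_def)
  next
    case True
    then have "a \<le> v (\<^bold>\<diamond> \<psi>)"
      using \<chi>(2)[OF \<psi>] linear_theory_theorem[OF P(1)] linear_theory_mp[OF P(1)] P(2) by (meson not_le)
    then show ?thesis
      using w(2)[rule_format, of \<psi>] True MG_valuationD(2)[OF v, of "\<^bold>\<box> \<psi>"]
      unfolding modal_compatible_def by (simp add: min_le_iff_disj)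
  qed
  moreover have "w \<phi> = 1"
    using w(2) sub by blast
  ultimately show ?thesis
    using w(1) a by (intro exI[of _ a] exI[of _ w]) simp
qed


section \<open>Limits of order patterns\<close>

text \<open>By the pigeonhole principle each single property becomes constant along a subsequence; a
  diagonal sequence treats all of them at once.\<close>

lemma eventually_decided_subsequence:
  fixes Q :: "nat \<Rightarrow> nat \<Rightarrow> bool"
  shows "\<exists>d :: nat \<Rightarrow> nat. strict_mono d \<and>
    (\<forall>k. (\<forall>\<^sub>F n in sequentially. Q k (d n)) \<or> (\<forall>\<^sub>F n in sequentially. \<not> Q k (d n)))"
proof -
  define decided where "decided k s \<longleftrightarrow> (\<forall>n. Q k (s n)) \<or> (\<forall>n. \<not> Q k (s n))" for k and s :: "nat \<Rightarrow> nat"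
  interpret subseqs decided
  proof
    fix k and s :: "nat \<Rightarrow> nat"
    have "{n. Q k (s n)} \<union> {n. \<not> Q k (s n)} = UNIV"
      by auto
    then have "infinite {n. Q k (s n)} \<or> infinite {n. \<not> Q k (s n)}"
      using infinite_UNIV_nat finite_UnI by metis
    then show "\<exists>r. strict_mono r \<and> decided k (s \<circ> r)"
    proof
      assume "infinite {n. Q k (s n)}"
      from infinite_enumerate[OF this] show ?thesis
        unfolding decided_def by auto
    next
      assume "infinite {n. \<not> Q k (s n)}"
      from infinite_enumerate[OF this] show ?thesis
        unfolding decided_def by auto
    qed
  qed
  have "(\<forall>\<^sub>F n in sequentially. Q k (diagseq n)) \<or> (\<forall>\<^sub>F n in sequentially. \<not> Q k (diagseq n))" for k
  proof -
    \<comment> \<open>Only the tail of the diagonal sequence is a subsequence of the one chosen for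
      \<open>k\<close>, hence the shift by \<open>Suc k\<close>.\<close>
    have "decided k (diagseq \<circ> (+) (Suc k))"
      by (rule diagseq_holds) (auto simp: decided_def)
    then have "(\<forall>n. Q k (diagseq (n + Suc k))) \<or> (\<forall>n. \<not> Q k (diagseq (n + Suc k)))"
      unfolding decided_def by (simp add: add.commute)
    then show ?thesis
      using eventually_sequentially_seg[of "\<lambda>n. Q k (diagseq n)" "Suc k"]
        eventually_sequentially_seg[of "\<lambda>n. \<not> Q k (diagseq n)" "Suc k"] by auto
  qed
  then show ?thesis
    using subseq_diagseq by blast
qed

definition order_agree :: "'a set \<Rightarrow> ('a \<Rightarrow> real) \<Rightarrow> ('a \<Rightarrow> real) \<Rightarrow> bool" where
  "order_agree S f h \<longleftrightarrow> (\<forall>x\<in>S. \<forall>y\<in>S. h x \<le> h y \<longleftrightarrow> f x \<le> f y)"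

text \<open>The order pattern on every finite set recurs infinitely often along the sequence. No
  convergence of the values themselves is claimed: it would not preserve strict inequalities.\<close>

lemma order_pattern_limit:
  fixes f :: "nat \<Rightarrow> 'a::countable \<Rightarrow> real"
  assumes b: "\<And>n. f n b = 0" and t: "\<And>n. f n t = 1"
  shows "\<exists>h. h b = 0 \<and> h t = 1 \<and> (\<forall>S N. finite S \<longrightarrow> (\<exists>n\<ge>N. order_agree S (f n) h))"
proof -
  obtain d where d: "strict_mono d" and k: "\<forall>k.
      (\<forall>\<^sub>F n in sequentially. case from_nat k of (x, y) \<Rightarrow> f (d n) x \<le> f (d n) y) \<or>
      (\<forall>\<^sub>F n in sequentially. \<not> (case from_nat k of (x, y) \<Rightarrow> f (d n) x \<le> f (d n) y))"
    using eventually_decided_subsequence[of "\<lambda>k n. case from_nat k of (x, y) \<Rightarrow> f n x \<le> f n y"] by blast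
  have dec: "(\<forall>\<^sub>F n in sequentially. f (d n) x \<le> f (d n) y) \<or>
      (\<forall>\<^sub>F n in sequentially. \<not> f (d n) x \<le> f (d n) y)" for x y
    using k[rule_format, of "to_nat (x, y)"] by (simp only: from_nat_to_nat case_prod_conv)
  \<comment> \<open>The limit order. Decidedness makes it total, and it also turns a failure of
    \<open>le\<close> into eventual failure of the comparison, so strict inequalities
    survive.\<close>
  define le where "le x y \<longleftrightarrow> (\<forall>\<^sub>F n in sequentially. f (d n) x \<le> f (d n) y)" for x y
  have total: "le x y \<or> le y x" for x y
    using dec[of x y] eventually_mono[of "\<lambda>n. \<not> f (d n) x \<le> f (d n) y" _ "\<lambda>n. f (d n) y \<le> f (d n) x"]
    unfolding le_def by auto
  have trans: "transp le"
    unfolding le_def by (rule transpI) (erule (1) eventually_elim2, rule order_trans)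
  let ?C = "{(b, 0, 0), (t, 1, 1)} :: ('a \<times> real \<times> real) set"
  have "le b t" "\<not> le t b" "le b b" "le t t"
    unfolding le_def using b t by auto
  then have "\<forall>(c, l, u)\<in>?C. \<forall>(d, l', u')\<in>?C. (le c d \<longrightarrow> l \<le> u') \<and> (\<not> le d c \<longrightarrow> l < u')"
    by simp
  from preorder_embedding_with_bounds[OF total trans _ this]
  obtain h :: "'a \<Rightarrow> real" where h: "\<forall>x y. h x \<le> h y \<longleftrightarrow> le x y"
    "\<forall>c l u. (c, l, u) \<in> ?C \<longrightarrow> l \<le> h c \<and> h c \<le> u"
    by blast
  have "\<exists>n\<ge>N. order_agree S (f n) h" if S: "finite S" for S N
  proof -
    have "\<forall>\<^sub>F n in sequentially. h x \<le> h y \<longleftrightarrow> f (d n) x \<le> f (d n) y" for x y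
      using dec[of x y] h(1) by (cases "h x \<le> h y") (auto simp: le_def)
    then have "\<forall>\<^sub>F n in sequentially. \<forall>x\<in>S. \<forall>y\<in>S. h x \<le> h y \<longleftrightarrow> f (d n) x \<le> f (d n) y"
      using S by (intro eventually_ball_finite ballI)
    moreover have "\<forall>\<^sub>F n in sequentially. N \<le> d n"
      using filterlim_subseq[OF d] by (simp add: filterlim_at_top)
    ultimately have "\<forall>\<^sub>F n in sequentially. N \<le> d n \<and> order_agree S (f (d n)) h"
      unfolding order_agree_def by eventually_elim blast
    then show ?thesis
      by (auto simp: eventually_sequentially)
  qed
  moreover have "h b = 0" "h t = 1"
    using h(2)[rule_format, of b 0 0] h(2)[rule_format, of t 1 1] by auto
  ultimately show ?thesis
    by blast
qed

lemma order_agree_eq: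
  "order_agree S f h \<Longrightarrow> x \<in> S \<Longrightarrow> y \<in> S \<Longrightarrow> h x = h y \<longleftrightarrow> f x = f y"
  unfolding order_agree_def by (metis order_antisym order_refl)

lemma order_agree_min:
  "order_agree S f h \<Longrightarrow> {x, y, z} \<subseteq> S \<Longrightarrow> h z = min (h x) (h y) \<longleftrightarrow> f z = min (f x) (f y)"
  using order_agree_eq[of S f h] unfolding order_agree_def by (simp add: min_def)

lemma order_agree_max:
  "order_agree S f h \<Longrightarrow> {x, y, z} \<subseteq> S \<Longrightarrow> h z = max (h x) (h y) \<longleftrightarrow> f z = max (f x) (f y)"
  using order_agree_eq[of S f h] unfolding order_agree_def by (simp add: max_def)

text \<open>The Goedel implication mentions the constant 1, so an element \<open>t\<close>
  representing it is needed to reduce the identity to comparisons.\<close>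

lemma order_agree_godel_imp:
  "order_agree S f h \<Longrightarrow> {x, y, z, t} \<subseteq> S \<Longrightarrow> h t = 1 \<Longrightarrow> f t = 1 \<Longrightarrow>
    h z = godel_imp (h x) (h y) \<longleftrightarrow> f z = godel_imp (f x) (f y)"
  using order_agree_eq[of S f h z t] order_agree_eq[of S f h z y]
  unfolding order_agree_def by (simp add: godel_imp_def)

lemma order_agree_min_le:
  "order_agree S f h \<Longrightarrow> {x, y, z} \<subseteq> S \<Longrightarrow> min (h x) (h y) \<le> h z \<longleftrightarrow> min (f x) (f y) \<le> f z"
  unfolding order_agree_def by (simp add: min_le_iff_disj)


section \<open>The tree of witnesses\<close>

text \<open>Nodes are lists of witnessing requests, most recent first: \<open>(True, \<phi>) # \<sigma>\<close> witnesses \<open>\<box>\<phi>\<close>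
  at \<open>\<sigma>\<close> and \<open>(False, \<phi>) # \<sigma>\<close> witnesses \<open>\<diamond>\<phi>\<close>. A node carries its accessibility degree from the
  parent (irrelevant at the root) and its valuation.\<close>

type_synonym node = "(bool \<times> fm) list"

fun witnesses :: "(fm \<Rightarrow> real) \<Rightarrow> bool \<times> fm \<Rightarrow> real \<Rightarrow> (fm \<Rightarrow> real) \<Rightarrow> bool" where
  "witnesses v (True, \<phi>) r w \<longleftrightarrow> v (\<^bold>\<box> \<phi>) = godel_imp r (w \<phi>)"
| "witnesses v (False, \<phi>) r w \<longleftrightarrow> v (\<^bold>\<diamond> \<phi>) = min r (w \<phi>)"

definition is_child :: "fm set \<Rightarrow> (fm \<Rightarrow> real) \<Rightarrow> bool \<times> fm \<Rightarrow> real \<times> (fm \<Rightarrow> real) \<Rightarrow> bool" where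
  "is_child F v x = (\<lambda>(r, w). MG_valuation W_Box w \<and> 0 \<le> r \<and> r \<le> 1 \<and>
    (\<forall>\<psi>\<in>F. modal_compatible v r w \<psi>) \<and> witnesses v x r w)"

primrec approx_tree :: "fm set \<Rightarrow> (fm \<Rightarrow> real) \<Rightarrow> node \<Rightarrow> real \<times> (fm \<Rightarrow> real)" where
  "approx_tree F v [] = (0, v)"
| "approx_tree F v (x # \<sigma>) = (SOME p. is_child F (snd (approx_tree F v \<sigma>)) x p)"

lemma is_child_exists:
  assumes "MG_valuation W_Box v" "finite F"
  shows "\<exists>p. is_child F v x p"
proof (cases x)
  case (Pair b \<phi>)
  show ?thesis
    using box_child[OF assms, of \<phi>] dia_child[OF assms, of \<phi>] Pair
    unfolding is_child_def by (cases b) auto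
qed

context
  fixes F :: "fm set" and v
  assumes v: "MG_valuation W_Box v" and F: "finite F"
begin

lemma approx_tree_valuation: "MG_valuation W_Box (snd (approx_tree F v \<sigma>))"
proof (induction \<sigma>)
  case (Cons x \<sigma>)
  have "is_child F (snd (approx_tree F v \<sigma>)) x (approx_tree F v (x # \<sigma>))"
    using someI_ex[OF is_child_exists[OF Cons F]] by simp
  then show ?case
    unfolding is_child_def by (simp only: case_prod_beta)
qed (simp add: v)

lemma approx_tree_child: "is_child F (snd (approx_tree F v \<sigma>)) x (approx_tree F v (x # \<sigma>))"
  using someI_ex[OF is_child_exists[OF approx_tree_valuation F]] by simp

lemma approx_tree_degree: "0 \<le> fst (approx_tree F v \<sigma>) \<and> fst (approx_tree F v \<sigma>) \<le> 1"
  using approx_tree_child unfolding is_child_def by (cases \<sigma>) (auto simp: case_prod_beta)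

end

text \<open>In contrast to \<open>is_child\<close>, compatibility is demanded for all formulas; this
  is what the limit gains over the approximations.\<close>

definition witness_tree :: "(node \<Rightarrow> real) \<Rightarrow> (node \<Rightarrow> fm \<Rightarrow> real) \<Rightarrow> bool" where
  "witness_tree r e \<longleftrightarrow> (\<forall>\<sigma>. 0 \<le> r \<sigma> \<and> r \<sigma> \<le> 1) \<and>
    (\<forall>\<sigma>. MG_valuation W_Box (e \<sigma>)) \<and>
    (\<forall>\<sigma> x \<psi>. modal_compatible (e \<sigma>) (r (x # \<sigma>)) (e (x # \<sigma>)) \<psi>) \<and>
    (\<forall>\<sigma> x. witnesses (e \<sigma>) x (r (x # \<sigma>)) (e (x # \<sigma>)))"

text \<open>Each single requirement on the tree concerns the order of finitely many values. It
  therefore passes to the limit from one sufficiently late approximation whose order pattern agrees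
  on these values.\<close>

lemma witness_tree_exists:
  assumes "\<not> MG_derives W_Box \<Gamma> \<phi>"
  shows "\<exists>r e. witness_tree r e \<and> (\<forall>\<gamma>\<in>\<Gamma>. e [] \<gamma> = 1) \<and> e [] \<phi> \<noteq> 1"
proof -
  obtain P where P: "linear_theory W_Box P" "\<Gamma> \<subseteq> P" "\<phi> \<notin> P"
    using linear_theory_extension[OF assms] by blast
  then have "\<^bold>\<bottom> \<notin> P"
    using linear_theory_mp[OF P(1) linear_theory_axiom[OF P(1) Bot_E]] by blast
  then obtain v where v: "MG_valuation W_Box v" "\<forall>\<phi>. v \<phi> = 1 \<longleftrightarrow> \<phi> \<in> P"
    using linear_theory_valuation[OF P(1)] by blast
  define F where "F n = {\<psi>::fm. to_nat \<psi> \<le> n}" for n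
  have F: "finite (F n)" for n
    unfolding F_def by (rule finite_imageD[of to_nat]) (auto intro: finite_subset[of _ "{..n}"] inj_onI)
  define T where "T n = approx_tree (F n) v" for n
  \<comment> \<open>A whole tree becomes one function on a countable index set: \<open>None\<close>
    selects the degree of a node, \<open>Some \<psi>\<close> the value of \<open>\<psi>\<close>
    there.\<close>
  define f where "f n = (\<lambda>(\<sigma>, q). case q of None \<Rightarrow> fst (T n \<sigma>) | Some \<psi> \<Rightarrow> snd (T n \<sigma>) \<psi>)" for n
  have f_simps: "f n (\<sigma>, None) = fst (T n \<sigma>)" "f n (\<sigma>, Some \<psi>) = snd (T n \<sigma>) \<psi>" for n \<sigma> \<psi>
    unfolding f_def by simp_all
  note T_val = approx_tree_valuation[OF v(1) F, folded T_def]
  note T_deg = approx_tree_degree[OF v(1) F, folded T_def]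
  note T_child = approx_tree_child[OF v(1) F, folded T_def]
  \<comment> \<open>Falsity and truth at the root serve as reference points for 0 and 1 in the
    limit.\<close>
  let ?b = "([], Some \<^bold>\<bottom>) :: node \<times> fm option" and ?t = "([], Some (\<^bold>\<not> \<^bold>\<bottom>)) :: node \<times> fm option"
  have fb: "f n ?b = 0" and ft: "f n ?t = 1" for n
    unfolding f_simps using MG_valuationD(3,6)[OF T_val] by (simp_all add: godel_imp_def)
  obtain h where hb: "h ?b = 0" and ht: "h ?t = 1"
    and agree: "\<And>S N. finite S \<Longrightarrow> \<exists>n\<ge>N. order_agree S (f n) h"
    using order_pattern_limit[of f ?b ?t] fb ft by blast
  have f01: "0 \<le> f n x \<and> f n x \<le> 1" for n x
    using T_deg[of n] MG_valuationD(1,2)[OF T_val[of n]] unfolding f_def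
    by (auto split: option.split prod.split)
  have h01: "0 \<le> h x \<and> h x \<le> 1" for x
  proof -
    obtain n where n: "order_agree {x, ?b, ?t} (f n) h"
      using agree[of "{x, ?b, ?t}"] by blast
    then show ?thesis
      using f01[of n x] hb ht fb[of n] ft[of n] unfolding order_agree_def by force
  qed
  have h_eq: "h x = h y" if "\<And>n. f n x = f n y" for x y
    using agree[of "{x, y}" 0] order_agree_eq[of "{x, y}" _ h x y] that by auto
  define r where "r \<sigma> = h (\<sigma>, None)" for \<sigma>
  define e where "e \<sigma> \<psi> = h (\<sigma>, Some \<psi>)" for \<sigma> \<psi>
  have e_imp: "e \<sigma> (\<psi> \<^bold>\<rightarrow> \<chi>) = godel_imp (e \<sigma> \<psi>) (e \<sigma> \<chi>)" for \<sigma> \<psi> \<chi>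
  proof -
    let ?S = "{(\<sigma>, Some \<psi>), (\<sigma>, Some \<chi>), (\<sigma>, Some (\<psi> \<^bold>\<rightarrow> \<chi>)), ?t}"
    obtain n where n: "order_agree ?S (f n) h"
      using agree[of ?S] by blast
    show ?thesis
      unfolding e_def order_agree_godel_imp[OF n order.refl ht ft] f_simps
      using MG_valuationD(6)[OF T_val] .
  qed
  have "MG_valuation W_Box (e \<sigma>)" for \<sigma>
    unfolding MG_valuation_def
  proof (intro conjI allI impI)
    show "0 \<le> e \<sigma> \<psi>" "e \<sigma> \<psi> \<le> 1" for \<psi>
      unfolding e_def using h01 by blast+
    show "e \<sigma> \<^bold>\<bottom> = 0"
      unfolding e_def hb[symmetric] by (rule h_eq) (simp add: f_simps MG_valuationD(3)[OF T_val])
    show "e \<sigma> (\<psi> \<^bold>\<and> \<chi>) = min (e \<sigma> \<psi>) (e \<sigma> \<chi>)" for \<psi> \<chi>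
    proof -
      let ?S = "{(\<sigma>, Some \<psi>), (\<sigma>, Some \<chi>), (\<sigma>, Some (\<psi> \<^bold>\<and> \<chi>))}"
      obtain n where n: "order_agree ?S (f n) h"
        using agree[of ?S] by blast
      show ?thesis
        unfolding e_def order_agree_min[OF n order.refl] f_simps using MG_valuationD(4)[OF T_val] .
    qed
    show "e \<sigma> (\<psi> \<^bold>\<or> \<chi>) = max (e \<sigma> \<psi>) (e \<sigma> \<chi>)" for \<psi> \<chi>
    proof -
      let ?S = "{(\<sigma>, Some \<psi>), (\<sigma>, Some \<chi>), (\<sigma>, Some (\<psi> \<^bold>\<or> \<chi>))}"
      obtain n where n: "order_agree ?S (f n) h"
        using agree[of ?S] by blast
      show ?thesis
        unfolding e_def order_agree_max[OF n order.refl] f_simps using MG_valuationD(5)[OF T_val] .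
    qed
    show "e \<sigma> (\<psi> \<^bold>\<rightarrow> \<chi>) = godel_imp (e \<sigma> \<psi>) (e \<sigma> \<chi>)" for \<psi> \<chi>
      by (rule e_imp)
    show "e \<sigma> \<psi> = 1" if "MG_theorem W_Box \<psi>" for \<psi>
      unfolding e_def ht[symmetric] using that
      by (intro h_eq) (simp add: ft f_simps(2)[of _ \<sigma>] MG_valuationD(7)[OF T_val])
  qed
  moreover have "modal_compatible (e \<sigma>) (r (x # \<sigma>)) (e (x # \<sigma>)) \<psi>" for \<sigma> x \<psi>
  proof -
    let ?S = "{(x # \<sigma>, None), (\<sigma>, Some (\<^bold>\<box> \<psi>)), (x # \<sigma>, Some \<psi>), (\<sigma>, Some (\<^bold>\<diamond> \<psi>))}"
    \<comment> \<open>The stage must be late enough for \<open>\<psi>\<close> to belong to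
      \<open>F n\<close>.\<close>
    obtain n where n: "to_nat \<psi> \<le> n" "order_agree ?S (f n) h"
      using agree[of ?S] by blast
    have "modal_compatible (snd (T n \<sigma>)) (fst (T n (x # \<sigma>))) (snd (T n (x # \<sigma>))) \<psi>"
      using T_child[of n \<sigma> x] n(1) unfolding is_child_def F_def by (simp add: case_prod_beta)
    then show ?thesis
      unfolding modal_compatible_def r_def e_def using order_agree_min_le[OF n(2)]
      by (simp add: f_simps)
  qed
  moreover have "witnesses (e \<sigma>) x (r (x # \<sigma>)) (e (x # \<sigma>))" for \<sigma> x
  proof -
    obtain c \<psi> where x: "x = (c, \<psi>)"
      by fastforce
    let ?S = "{(x # \<sigma>, None), (\<sigma>, Some (\<^bold>\<box> \<psi>)), (x # \<sigma>, Some \<psi>), (\<sigma>, Some (\<^bold>\<diamond> \<psi>)), ?t}"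
    obtain n where n: "order_agree ?S (f n) h"
      using agree[of ?S] by blast
    have "witnesses (snd (T n \<sigma>)) x (fst (T n (x # \<sigma>))) (snd (T n (x # \<sigma>)))"
      using T_child[of n \<sigma> x] unfolding is_child_def by (simp add: case_prod_beta)
    then show ?thesis
      unfolding r_def e_def x using order_agree_min[OF n] order_agree_godel_imp[OF n _ ht ft]
      by (cases c) (simp_all add: f_simps x)
  qed
  moreover have "e [] \<psi> = 1 \<longleftrightarrow> \<psi> \<in> P" for \<psi>
  proof -
    obtain n where n: "order_agree {([], Some \<psi>), ?t} (f n) h"
      using agree[of "{([], Some \<psi>), ?t}"] by blast
    have "e [] \<psi> = 1 \<longleftrightarrow> f n ([], Some \<psi>) = 1"
      using order_agree_eq[OF n, of "([], Some \<psi>)" ?t] ht ft unfolding e_def by simp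
    then show ?thesis
      using v(2) by (simp add: f_simps T_def)
  qed
  moreover have "0 \<le> r \<sigma> \<and> r \<sigma> \<le> 1" for \<sigma>
    unfolding r_def by (rule h01)
  ultimately show ?thesis
    using P(2,3) unfolding witness_tree_def by (intro exI[of _ r] exI[of _ e]) auto
qed


section \<open>The witnessed model of a tree\<close>

text \<open>The injection \<open>\<iota>\<close> places the nodes in an arbitrary world type. A node
  sees its children to the degree they carry and all other nodes to degree 0.\<close>

definition tree_model :: "(node \<Rightarrow> 'w) \<Rightarrow> (node \<Rightarrow> real) \<Rightarrow> (node \<Rightarrow> fm \<Rightarrow> real) \<Rightarrow> 'w gk_structure" where
  "tree_model \<iota> r e = \<lparr>worlds = range \<iota>,
    acc = (\<lambda>v w. if inv \<iota> w \<noteq> [] \<and> tl (inv \<iota> w) = inv \<iota> v then r (inv \<iota> w) else 0),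
    atom_val = (\<lambda>v p. e (inv \<iota> v) (Var p))\<rparr>"

context
  fixes \<iota> :: "node \<Rightarrow> 'w" and r e
  assumes \<iota>: "inj \<iota>" and tree: "witness_tree r e"
begin

lemma tree_model_simps:
  "worlds (tree_model \<iota> r e) = range \<iota>"
  "acc (tree_model \<iota> r e) (\<iota> \<sigma>) (\<iota> \<tau>) = (if \<tau> \<noteq> [] \<and> tl \<tau> = \<sigma> then r \<tau> else 0)"
  "atom_val (tree_model \<iota> r e) (\<iota> \<sigma>) p = e \<sigma> (Var p)"
  using \<iota> by (simp_all add: tree_model_def)

lemma tree_valuation: "MG_valuation W_Box (e \<sigma>)"
  using tree unfolding witness_tree_def by blast

lemma tree_compatible: "modal_compatible (e \<sigma>) (r (x # \<sigma>)) (e (x # \<sigma>)) \<psi>"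
  using tree unfolding witness_tree_def by blast

lemma tree_witnesses: "witnesses (e \<sigma>) x (r (x # \<sigma>)) (e (x # \<sigma>))"
  using tree unfolding witness_tree_def by blast

text \<open>Compatibility makes the value of a modal formula a bound over the children, and the
  child created for that formula attains it. Other worlds have degree 0 and contribute 1 to an
  infimum and 0 to a supremum.\<close>

lemma eval_tree_model: "eval (tree_model \<iota> r e) (\<iota> \<sigma>) \<psi> = e \<sigma> \<psi>"
proof (induction \<psi> arbitrary: \<sigma>)
  case (Box \<psi>)
  let ?g = "\<lambda>w. godel_imp (acc (tree_model \<iota> r e) (\<iota> \<sigma>) w) (eval (tree_model \<iota> r e) w \<psi>)"
  have g: "?g (\<iota> \<tau>) = godel_imp (if \<tau> \<noteq> [] \<and> tl \<tau> = \<sigma> then r \<tau> else 0) (e \<tau> \<psi>)" for \<tau>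
    by (simp only: tree_model_simps Box)
  have "Inf (?g ` range \<iota>) = e \<sigma> (\<^bold>\<box> \<psi>)"
  proof (rule cInf_eq_minimum)
    have "?g (\<iota> ((True, \<psi>) # \<sigma>)) = e \<sigma> (\<^bold>\<box> \<psi>)"
      using tree_witnesses[of \<sigma> "(True, \<psi>)"] unfolding g by simp
    from this[symmetric] show "e \<sigma> (\<^bold>\<box> \<psi>) \<in> ?g ` range \<iota>"
      by (rule image_eqI) (rule rangeI)
    have "e \<sigma> (\<^bold>\<box> \<psi>) \<le> ?g (\<iota> \<tau>)" for \<tau>
      using tree_compatible[of \<sigma> _ \<psi>] MG_valuationD(1,2)[OF tree_valuation]
      unfolding g modal_compatible_def by (cases \<tau>) (auto simp: godel_imp_def min_le_iff_disj)
    then show "e \<sigma> (\<^bold>\<box> \<psi>) \<le> x" if "x \<in> ?g ` range \<iota>" for x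
      using that by blast
  qed
  then show ?case
    by (simp add: tree_model_simps(1))
next
  case (Dia \<psi>)
  let ?g = "\<lambda>w. min (acc (tree_model \<iota> r e) (\<iota> \<sigma>) w) (eval (tree_model \<iota> r e) w \<psi>)"
  have g: "?g (\<iota> \<tau>) = min (if \<tau> \<noteq> [] \<and> tl \<tau> = \<sigma> then r \<tau> else 0) (e \<tau> \<psi>)" for \<tau>
    by (simp only: tree_model_simps Dia)
  have "Sup (?g ` range \<iota>) = e \<sigma> (\<^bold>\<diamond> \<psi>)"
  proof (rule cSup_eq_maximum)
    have "?g (\<iota> ((False, \<psi>) # \<sigma>)) = e \<sigma> (\<^bold>\<diamond> \<psi>)"
      using tree_witnesses[of \<sigma> "(False, \<psi>)"] unfolding g by simp
    from this[symmetric] show "e \<sigma> (\<^bold>\<diamond> \<psi>) \<in> ?g ` range \<iota>"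
      by (rule image_eqI) (rule rangeI)
    have "?g (\<iota> \<tau>) \<le> e \<sigma> (\<^bold>\<diamond> \<psi>)" for \<tau>
      using tree_compatible[of \<sigma> _ \<psi>] MG_valuationD(1,2)[OF tree_valuation]
      unfolding g modal_compatible_def by (cases \<tau>) (auto simp: min_le_iff_disj)
    then show "x \<le> e \<sigma> (\<^bold>\<diamond> \<psi>)" if "x \<in> ?g ` range \<iota>" for x
      using that by blast
  qed
  then show ?case
    by (simp add: tree_model_simps(1))
qed (simp_all add: tree_model_simps MG_valuationD(3-6)[OF tree_valuation])

lemma tree_model_witnessed: "tree_model \<iota> r e \<in> witnessed_gk_models"
proof -
  have "gk_model (tree_model \<iota> r e)"
    unfolding gk_model_def tree_model_simps
    using tree MG_valuationD(1,2)[OF tree_valuation]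
    by (auto simp: tree_model_simps witness_tree_def)
  moreover have "witnessed (tree_model \<iota> r e)"
    unfolding witnessed_def tree_model_simps(1)
  proof (intro ballI allI conjI)
    fix v \<psi> assume "v \<in> range \<iota>"
    then obtain \<sigma> where v: "v = \<iota> \<sigma>" by blast
    show "\<exists>w\<in>range \<iota>. eval (tree_model \<iota> r e) v (\<^bold>\<box> \<psi>) =
        godel_imp (acc (tree_model \<iota> r e) v w) (eval (tree_model \<iota> r e) w \<psi>)"
      unfolding v eval_tree_model using tree_witnesses[of \<sigma> "(True, \<psi>)"]
      by (intro bexI[of _ "\<iota> ((True, \<psi>) # \<sigma>)"]) (simp_all add: eval_tree_model tree_model_simps)
    show "\<exists>w\<in>range \<iota>. eval (tree_model \<iota> r e) v (\<^bold>\<diamond> \<psi>) =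
        min (acc (tree_model \<iota> r e) v w) (eval (tree_model \<iota> r e) w \<psi>)"
      unfolding v eval_tree_model using tree_witnesses[of \<sigma> "(False, \<psi>)"]
      by (intro bexI[of _ "\<iota> ((False, \<psi>) # \<sigma>)"]) (simp_all add: eval_tree_model tree_model_simps)
  qed
  ultimately show ?thesis
    unfolding witnessed_gk_models_def by blast
qed

end

theorem theorem4:
  assumes "infinite (UNIV :: 'w set)"
  shows "complete_wrt (MG_derives W_Box) (witnessed_gk_models :: 'w gk_structure set)"
  unfolding complete_wrt_def
proof (intro allI iffI)
  fix \<Gamma> \<phi>
  show "local_consequence (witnessed_gk_models :: 'w gk_structure set) \<Gamma> \<phi>"
    if "MG_derives W_Box \<Gamma> \<phi>"
    using that by (rule MG_derives_sound)
  show "MG_derives W_Box \<Gamma> \<phi>"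
    if cons: "local_consequence (witnessed_gk_models :: 'w gk_structure set) \<Gamma> \<phi>"
  proof (rule ccontr)
    assume "\<not> MG_derives W_Box \<Gamma> \<phi>"
    then obtain r e where tree: "witness_tree r e" "\<forall>\<gamma>\<in>\<Gamma>. e [] \<gamma> = 1" "e [] \<phi> \<noteq> 1"
      using witness_tree_exists by blast
    \<comment> \<open>There are only countably many nodes, so the tree fits into any infinite type
      of worlds.\<close>
    obtain j :: "nat \<Rightarrow> 'w" where "inj j"
      using infinite_countable_subset[OF assms] by blast
    then have \<iota>: "inj (j \<circ> (to_nat :: node \<Rightarrow> nat))"
      by (intro inj_compose) simp_all
    have "\<forall>v\<in>range (j \<circ> (to_nat :: node \<Rightarrow> nat)).
        (\<forall>\<gamma>\<in>\<Gamma>. eval (tree_model (j \<circ> to_nat) r e) v \<gamma> = 1) \<longrightarrow>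
        eval (tree_model (j \<circ> to_nat) r e) v \<phi> = 1"
      using cons tree_model_witnessed[OF \<iota> tree(1)] tree_model_simps(1)[OF \<iota> tree(1)]
      unfolding local_consequence_def by metis
    then show False
      using tree(2,3) eval_tree_model[OF \<iota> tree(1)] by (metis rangeI)
  qed
qed

end
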